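(* Consider $N$ heterogeneous SISO general nonlinear agents $\dot{x}_i=f_i(x_i,u_i)$, $y_i=h_i(x_i)$, $i=1,\ldots,N$, with relative degrees $r_i$ (in the sense for general nonlinear agents given in the context), for which the internal dynamics of the augmented agents are input-to-state stable, and which communicate over a time-invariant directed graph $\mathcal{G}$ that has a spanning tree, with Laplacian $\mathcal{L}$. Let $r=\max_ir_i$, and let $\tilde{b}_2,\ldots,\tilde{b}_{r+1}$ be real numbers such that all roots of $s^{r+1}+\tilde{b}_{r+1}s^r+\cdots+\tilde{b}_2s=0$ are real and non-positive and, moreover, the matrix $\tilde{A}$ (defined in the context) has only one eigenvalue at the origin while its other eigenvalues belong to the open left half complex plane. Let $\tilde{\nu}^T\in\mathbb{R}^{1\times(r+1)}$ be the left eigenvector of $\tilde{A}$ associated with the eigenvalue $0$. Let $\tilde{q}_1>0$, $\tilde{r}>0$, $\tilde{Q}_1=\tilde{\nu}\tilde{q}_1\tilde{\nu}^T$, and assume that $(\tilde{Q}_1^{1/2},\tilde{A})$ is observable. Let $\mu>0$. Then, under the dynamic controllers defined in the context, with inputs $\tilde{v}_i$ and extended states $\zeta_i$, together with the rank-$1$ cooperative inputs $$\tilde{v}_i=-\mu\sqrt{\tilde{q}_1\tilde{r}}\,\tilde{\nu}^T\sum_{j\in\mathcal{N}_i}a_{ij}\big(\zeta_i(t)-\zeta_j(t)\big),\qquad i=1,\ldots,N,$$ the multi-agent system reaches an output consensus, i.e. $\lim_{t\to\infty}|y_i(t)-y_j(t)|=0$ for all $i,j=1,\ldots,N$. Furthermore,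 the consensus speed, i.e. the smallest non-zero absolute value of the real parts of the closed-loop eigenvalues (of the linearized multi-agent system), is equal to $$\min\left\{\mu\sqrt{\tilde{q}_1\tilde{r}}\,\tilde{B}^T\tilde{\nu}\,\mathrm{Re}(\lambda_{\min}(\mathcal{L})),\ \lambda_{\min}(-\tilde{A})\right\}.$$
   Context: Graph. $\mathcal{G}$ has vertices $\{1,\ldots,N\}$ and edges $e_{ij}\in\mathcal{E}$ if agent $i$ receives information from agent $j$ (information flows from $j$ to $i$); $a_{ij}>0$ if $e_{ij}\in\mathcal{E}$ and $a_{ij}=0$ otherwise; $\mathcal{N}_i=\{j:e_{ij}\in\mathcal{E}\}$. The Laplacian is $\mathcal{L}=\mathcal{D}-\mathcal{A}$ with $\mathcal{A}=[a_{ij}]$ and $\mathcal{D}=\mathrm{diag}\{\sum_ja_{ij}\}$. $\mathcal{G}$ has a spanning tree if there is a root node from which there are directed paths (along the direction of information flow) to every other node. $\lambda_{\min}(M)$ denotes the eigenvalue of $M$ with smallest non-zero real part. Agents. $x_i\in\mathbb{R}^{n_i}$, $u_i,y_i\in\mathbb{R}$; $f_i$ ($\mathbb{R}^{n_i}$-valued) and $h_i$ (scalar) are continuous, differentiable nonlinear functions (as often as needed for the derivatives below). $L_fh(x)=(\partial h(x)/\partial x)f(x)$. The general nonlinear agent has relative degree $r_i$ if $\frac{\partial}{\partial u_i}L_{f_i}^kh_i(x_i)=0$ for $k=0,\ldots,r_i-1$ and $\frac{\partial}{\partial u_i}L_{f_i}^{r_i}h_i(x_i)\neq 0$ (Lie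 derivatives in $x_i$ along $f_i(\cdot,u_i)$). Augmented agents. Put $\tilde{x}_i=[x_i^T,u_i]^T$, $\tilde{f}_i(\tilde{x}_i)=[f_i(x_i,u_i)^T,0]^T$, $\tilde{g}_i(\tilde{x}_i)=[\mathbf{0}_{n_i}^T,1]^T$, $\tilde{h}_i(\tilde{x}_i)=h_i(x_i)$, where $\mathbf{0}_{n_i}$ is the zero vector in $\mathbb{R}^{n_i}$, so that $\dot{\tilde{x}}_i=\tilde{f}_i(\tilde{x}_i)+\tilde{g}_i(\tilde{x}_i)\dot{u}_i$, $y_i=\tilde{h}_i(\tilde{x}_i)$; this affine agent with input $\dot u_i$ has relative degree $r_i+1$ (that is, $L_{\tilde g_i}L_{\tilde f_i}^k\tilde h_i=0$ for $k=0,\ldots,r_i-1$ and $L_{\tilde g_i}L_{\tilde f_i}^{r_i}\tilde h_i\ne0$). It is brought by a diffeomorphism $\tilde{\Phi}_i(\tilde{x}_i)=[\tilde{\xi}_i^T,\tilde{\eta}_i^T]^T$, with $\tilde{\xi}_i\in\mathbb{R}^{r_i+1}$, $\tilde{\xi}_{i,k}=L_{\tilde f_i}^{k-1}\tilde{h}_i(\tilde{x}_i)$, to the normal form $\dot{\tilde\xi}_{i,k}=\tilde\xi_{i,k+1}$ for $k=1,\ldots,r_i$, $\dot{\tilde\xi}_{i,r_i+1}=\tilde\alpha_i(\tilde\xi_i,\tilde\eta_i)+\tilde\beta_i(\tilde\xi_i,\tilde\eta_i)\dot u_i$, with internal dynamics $\dot{\tilde\eta}_i=\tilde\vartheta_i(\tilde\xi_i,\tilde\eta_i)$,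 $y_i=\tilde\xi_{i,1}$, where $\tilde\alpha_i=L_{\tilde f_i}^{r_i+1}\tilde h_i$, $\tilde\beta_i=L_{\tilde g_i}L_{\tilde f_i}^{r_i}\tilde h_i$. The internal dynamics is assumed input-to-state stable with input $\tilde\xi_i$. Dynamic controllers. For $r_i<r$, with state $\tilde\phi_i\in\mathbb{R}^{r-r_i}$ and new input $\tilde v_i\in\mathbb{R}$, $$\dot{\tilde\phi}_i=\tilde D_i\tilde\xi_i+\tilde E_i\tilde\phi_i+\tilde G_i\tilde v_i,\qquad w_i=\tilde H_i\tilde\phi_i-\frac{\tilde\alpha_i(\tilde\xi_i,\tilde\eta_i)}{\tilde\beta_i(\tilde\xi_i,\tilde\eta_i)},\qquad \dot u_i=w_i,$$ where $\tilde D_i\in\mathbb{R}^{(r-r_i)\times(r_i+1)}$ is zero except for its last row $[0,-\tilde b_2,\ldots,-\tilde b_{r_i+1}]$; $\tilde E_i\in\mathbb{R}^{(r-r_i)\times(r-r_i)}$ has ones on the superdiagonal, last row $[-\tilde b_{r_i+2},-\tilde b_{r_i+3},\ldots,-\tilde b_{r+1}]$, and zeros elsewhere; $\tilde G_i=[0,\ldots,0,1]^T\in\mathbb{R}^{r-r_i}$; $\tilde H_i=[1/\tilde\beta_i(\tilde\xi_i,\tilde\eta_i),0,\ldots,0]\in\mathbb{R}^{1\times(r-r_i)}$. For $r_i=r$ there is no $\tilde\phi_i$ and $\dot u_i=w_i=\tilde\beta_i^{-1}(-\tilde\alpha_i-\sum_{k=2}^{r+1}\tilde b_k\tilde\xi_{i,k}+\tilde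 v_i)$. Put $\zeta_i=[\tilde\xi_i^T,\tilde\phi_i^T]^T\in\mathbb{R}^{r+1}$. With these controllers every agent satisfies $\dot\zeta_i=\tilde A\zeta_i+\tilde B\tilde v_i$, where $\tilde A\in\mathbb{R}^{(r+1)\times(r+1)}$ has ones on the superdiagonal, last row $[0,-\tilde b_2,-\tilde b_3,\ldots,-\tilde b_{r+1}]$ and zeros elsewhere, and $\tilde B=[0,\ldots,0,1]^T\in\mathbb{R}^{r+1}$. The closed-loop linearized multi-agent system is the linear system for $[\zeta_1^T,\ldots,\zeta_N^T]^T$ with matrix $I_N\otimes\tilde A-\mu\sqrt{\tilde q_1\tilde r}\,\mathcal{L}\otimes(\tilde B\tilde\nu^T)$.
   Formalization: Observability, which is impossible here since the left eigenvector annihilates the matrix, is relaxed to observability or detectability; the left eigenvector is taken with positive product with B (otherwise the formula is negative); at least two agents are assumed. *)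

theory Defs
  imports
    "HOL-Analysis.Analysis"
    "Jordan_Normal_Form.Spectral_Radius"
    "Jordan_Normal_Form.DL_Rank"
begin

unbundle no vec_syntax
unbundle no inner_syntax

text \<open>
  The state dimensions vary with the agent, so a point of \<open>R\<^sup>n\<close> is a function
  on the naturals that vanishes from index \<open>n\<close> on; components are counted from 0.
  Continuity refers to the product topology, which is the usual topology on \<open>Rn n\<close>.
\<close>

definition Rn :: "nat \<Rightarrow> (nat \<Rightarrow> real) set" where
  "Rn n = {x. \<forall>k\<ge>n. x k = 0}"

definition enorm :: "nat \<Rightarrow> (nat \<Rightarrow> real) \<Rightarrow> real" where
  "enorm n x = L2_set x {..<n}"

definition partial :: "nat \<Rightarrow> ((nat \<Rightarrow> real) \<Rightarrow> real) \<Rightarrow> (nat \<Rightarrow> real) \<Rightarrow> real" where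
  "partial k F x = deriv (\<lambda>s. F (x(k := s))) (x k)"

text \<open>\<open>Ck m n F\<close>: \<open>F\<close> is \<open>m\<close> times continuously differentiable on \<open>R\<^sup>n\<close>.\<close>

fun Ck :: "nat \<Rightarrow> nat \<Rightarrow> ((nat \<Rightarrow> real) \<Rightarrow> real) \<Rightarrow> bool" where
  "Ck 0 n F \<longleftrightarrow> continuous_on (Rn n) F"
| "Ck (Suc m) n F \<longleftrightarrow> continuous_on (Rn n) F \<and>
     (\<forall>k<n. (\<forall>x\<in>Rn n. (\<lambda>s. F (x(k := s))) field_differentiable (at (x k))) \<and>
            Ck m n (partial k F))"

definition lie :: "nat \<Rightarrow> ((nat \<Rightarrow> real) \<Rightarrow> nat \<Rightarrow> real) \<Rightarrow>
    ((nat \<Rightarrow> real) \<Rightarrow> real) \<Rightarrow> (nat \<Rightarrow> real) \<Rightarrow> real" where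
  "lie n F \<phi> = (\<lambda>z. \<Sum>k<n. partial k \<phi> z * F z k)"

text \<open>Lie derivative in the state only, along \<open>f(\<cdot>, u)\<close>, of a function of state and input.\<close>

definition lie_state :: "nat \<Rightarrow> ((nat \<Rightarrow> real) \<Rightarrow> real \<Rightarrow> nat \<Rightarrow> real) \<Rightarrow>
    ((nat \<Rightarrow> real) \<Rightarrow> real \<Rightarrow> real) \<Rightarrow> (nat \<Rightarrow> real) \<Rightarrow> real \<Rightarrow> real" where
  "lie_state n f \<phi> = (\<lambda>x u. \<Sum>k<n. partial k (\<lambda>x'. \<phi> x' u) x * f x u k)"

record agent =
  sdim :: nat
  dyn :: "(nat \<Rightarrow> real) \<Rightarrow> real \<Rightarrow> nat \<Rightarrow> real"
  out :: "(nat \<Rightarrow> real) \<Rightarrow> real"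

definition relative_degree :: "agent \<Rightarrow> nat \<Rightarrow> bool" where
  "relative_degree S \<rho> \<longleftrightarrow> (\<forall>x\<in>Rn (sdim S). \<forall>u.
     (\<forall>k<\<rho>. deriv (\<lambda>u. (lie_state (sdim S) (dyn S) ^^ k) (\<lambda>x u. out S x) x u) u = 0) \<and>
     deriv (\<lambda>u. (lie_state (sdim S) (dyn S) ^^ \<rho>) (\<lambda>x u. out S x) x u) u \<noteq> 0)"

text \<open>An augmented state carries the \<open>n\<close> state components and, at index \<open>n\<close>, the input.\<close>

definition aug :: "nat \<Rightarrow> (nat \<Rightarrow> real) \<Rightarrow> real \<Rightarrow> nat \<Rightarrow> real" where
  "aug n x u = (\<lambda>k. if k < n then x k else if k = n then u else 0)"

definition state_part :: "nat \<Rightarrow> (nat \<Rightarrow> real) \<Rightarrow> nat \<Rightarrow> real" where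
  "state_part n z = (\<lambda>k. if k < n then z k else 0)"

definition aug_f :: "agent \<Rightarrow> (nat \<Rightarrow> real) \<Rightarrow> nat \<Rightarrow> real" where
  "aug_f S z = (\<lambda>k. if k < sdim S then dyn S (state_part (sdim S) z) (z (sdim S)) k else 0)"

definition aug_g :: "agent \<Rightarrow> (nat \<Rightarrow> real) \<Rightarrow> nat \<Rightarrow> real" where
  "aug_g S z = (\<lambda>k. if k = sdim S then 1 else 0)"

definition aug_h :: "agent \<Rightarrow> (nat \<Rightarrow> real) \<Rightarrow> real" where
  "aug_h S z = out S (state_part (sdim S) z)"

text \<open>
  The orders of differentiability are those needed for the Lie derivatives of the output
  up to order \<open>\<rho> + 1\<close> to exist and be continuous.
\<close>

definition smooth_agent :: "agent \<Rightarrow> nat \<Rightarrow> bool" where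
  "smooth_agent S \<rho> \<longleftrightarrow> Ck (\<rho> + 1) (sdim S) (out S) \<and>
     (\<forall>k<sdim S. Ck \<rho> (sdim S + 1) (\<lambda>z. aug_f S z k))"

definition Lf_h :: "agent \<Rightarrow> nat \<Rightarrow> (nat \<Rightarrow> real) \<Rightarrow> real" where
  "Lf_h S k = (lie (sdim S + 1) (aug_f S) ^^ k) (aug_h S)"

definition join :: "nat \<Rightarrow> (nat \<Rightarrow> real) \<Rightarrow> (nat \<Rightarrow> real) \<Rightarrow> nat \<Rightarrow> real" where
  "join m \<xi> \<eta> = (\<lambda>k. if k < m then \<xi> k else \<eta> (k - m))"

definition xi :: "agent \<Rightarrow> nat \<Rightarrow> (nat \<Rightarrow> real) \<Rightarrow> nat \<Rightarrow> real" where
  "xi S \<rho> z = (\<lambda>k. if k < \<rho> + 1 then Lf_h S k z else 0)"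

text \<open>\<open>\<psi> k\<close>, for \<open>k < sdim S - \<rho>\<close>, are the coordinate functions of the internal state.\<close>

definition eta :: "agent \<Rightarrow> nat \<Rightarrow> (nat \<Rightarrow> (nat \<Rightarrow> real) \<Rightarrow> real) \<Rightarrow> (nat \<Rightarrow> real) \<Rightarrow> nat \<Rightarrow> real" where
  "eta S \<rho> \<psi> z = (\<lambda>k. if k < sdim S - \<rho> then \<psi> k z else 0)"

definition Phi :: "agent \<Rightarrow> nat \<Rightarrow> (nat \<Rightarrow> (nat \<Rightarrow> real) \<Rightarrow> real) \<Rightarrow> (nat \<Rightarrow> real) \<Rightarrow> nat \<Rightarrow> real" where
  "Phi S \<rho> \<psi> z = join (\<rho> + 1) (xi S \<rho> z) (eta S \<rho> \<psi> z)"

definition Phi_inv :: "agent \<Rightarrow> nat \<Rightarrow> (nat \<Rightarrow> (nat \<Rightarrow> real) \<Rightarrow> real) \<Rightarrow>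
    (nat \<Rightarrow> real) \<Rightarrow> (nat \<Rightarrow> real) \<Rightarrow> nat \<Rightarrow> real" where
  "Phi_inv S \<rho> \<psi> \<xi> \<eta> = inv_into (Rn (sdim S + 1)) (Phi S \<rho> \<psi>) (join (\<rho> + 1) \<xi> \<eta>)"

text \<open>
  \<open>Phi\<close> is a global diffeomorphism, and the internal coordinates are chosen with vanishing
  Lie derivative along \<open>aug_g\<close>, so that the internal dynamics does not involve the input.
\<close>

definition normal_form :: "agent \<Rightarrow> nat \<Rightarrow> (nat \<Rightarrow> (nat \<Rightarrow> real) \<Rightarrow> real) \<Rightarrow> bool" where
  "normal_form S \<rho> \<psi> \<longleftrightarrow> \<rho> \<le> sdim S \<and>
     bij_betw (Phi S \<rho> \<psi>) (Rn (sdim S + 1)) (Rn (sdim S + 1)) \<and>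
     (\<forall>k<sdim S + 1. Ck 1 (sdim S + 1) (\<lambda>z. Phi S \<rho> \<psi> z k)) \<and>
     (\<forall>k<sdim S + 1. Ck 1 (sdim S + 1)
        (\<lambda>p. inv_into (Rn (sdim S + 1)) (Phi S \<rho> \<psi>) p k)) \<and>
     (\<forall>k<sdim S - \<rho>. \<forall>z\<in>Rn (sdim S + 1). lie (sdim S + 1) (aug_g S) (\<psi> k) z = 0)"

definition nf_alpha :: "agent \<Rightarrow> nat \<Rightarrow> (nat \<Rightarrow> (nat \<Rightarrow> real) \<Rightarrow> real) \<Rightarrow>
    (nat \<Rightarrow> real) \<Rightarrow> (nat \<Rightarrow> real) \<Rightarrow> real" where
  "nf_alpha S \<rho> \<psi> \<xi> \<eta> = Lf_h S (\<rho> + 1) (Phi_inv S \<rho> \<psi> \<xi> \<eta>)"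

definition nf_beta :: "agent \<Rightarrow> nat \<Rightarrow> (nat \<Rightarrow> (nat \<Rightarrow> real) \<Rightarrow> real) \<Rightarrow>
    (nat \<Rightarrow> real) \<Rightarrow> (nat \<Rightarrow> real) \<Rightarrow> real" where
  "nf_beta S \<rho> \<psi> \<xi> \<eta> = lie (sdim S + 1) (aug_g S) (Lf_h S \<rho>) (Phi_inv S \<rho> \<psi> \<xi> \<eta>)"

definition nf_theta :: "agent \<Rightarrow> nat \<Rightarrow> (nat \<Rightarrow> (nat \<Rightarrow> real) \<Rightarrow> real) \<Rightarrow>
    (nat \<Rightarrow> real) \<Rightarrow> (nat \<Rightarrow> real) \<Rightarrow> nat \<Rightarrow> real" where
  "nf_theta S \<rho> \<psi> \<xi> \<eta> = (\<lambda>k. lie (sdim S + 1) (aug_f S) (\<psi> k) (Phi_inv S \<rho> \<psi> \<xi> \<eta>))"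

definition class_K :: "(real \<Rightarrow> real) \<Rightarrow> bool" where
  "class_K \<gamma> \<longleftrightarrow> continuous_on {0..} \<gamma> \<and> strict_mono_on {0..} \<gamma> \<and> \<gamma> 0 = 0"

definition class_KL :: "(real \<Rightarrow> real \<Rightarrow> real) \<Rightarrow> bool" where
  "class_KL \<beta> \<longleftrightarrow> continuous_on ({0..} \<times> {0..}) (\<lambda>(s, t). \<beta> s t) \<and>
     (\<forall>t\<ge>0. class_K (\<lambda>s. \<beta> s t)) \<and>
     (\<forall>s\<ge>0. antimono_on {0..} (\<beta> s) \<and> (\<beta> s \<longlongrightarrow> 0) at_top)"

text \<open>
  Input-to-state stability of \<open>\<eta>' = F \<xi> \<eta>\<close> with input in \<open>R\<^sup>m\<close> and state in \<open>R\<^sup>n\<close>.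
  The estimate is required on every interval \<open>[0, T)\<close> on which a solution exists.
\<close>

definition iss :: "nat \<Rightarrow> nat \<Rightarrow> ((nat \<Rightarrow> real) \<Rightarrow> (nat \<Rightarrow> real) \<Rightarrow> nat \<Rightarrow> real) \<Rightarrow> bool" where
  "iss m n F \<longleftrightarrow> (\<exists>\<beta> \<gamma>. class_KL \<beta> \<and> class_K \<gamma> \<and>
     (\<forall>T>0. \<forall>\<xi> \<eta>.
        (\<forall>k<m. continuous_on {0..<T} (\<lambda>t. \<xi> t k)) \<and>
        (\<forall>t\<in>{0..<T}. \<xi> t \<in> Rn m \<and> \<eta> t \<in> Rn n \<and>
           (\<forall>k<n. ((\<lambda>s. \<eta> s k) has_real_derivative F (\<xi> t) (\<eta> t) k) (at t within {0..<T})))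
        \<longrightarrow> (\<forall>t\<in>{0..<T}.
               enorm n (\<eta> t) \<le> \<beta> (enorm n (\<eta> 0)) t + \<gamma> (SUP s\<in>{0..t}. enorm m (\<xi> s)))))"

text \<open>The coefficients are \<open>b k\<close> for \<open>2 \<le> k \<le> r + 1\<close>; matrix indices are counted from 0.\<close>

definition A_mat :: "nat \<Rightarrow> (nat \<Rightarrow> real) \<Rightarrow> real mat" where
  "A_mat r b = mat (r + 1) (r + 1) (\<lambda>(k, l).
     if k = r then (if l = 0 then 0 else - b (l + 1))
     else if l = k + 1 then 1 else 0)"

definition B_vec :: "nat \<Rightarrow> real vec" where
  "B_vec r = unit_vec (r + 1) r"

definition D_mat :: "nat \<Rightarrow> nat \<Rightarrow> (nat \<Rightarrow> real) \<Rightarrow> real mat" where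
  "D_mat r \<rho> b = mat (r - \<rho>) (\<rho> + 1) (\<lambda>(k, l).
     if k = r - \<rho> - 1 \<and> l \<noteq> 0 then - b (l + 1) else 0)"

definition E_mat :: "nat \<Rightarrow> nat \<Rightarrow> (nat \<Rightarrow> real) \<Rightarrow> real mat" where
  "E_mat r \<rho> b = mat (r - \<rho>) (r - \<rho>) (\<lambda>(k, l).
     if k = r - \<rho> - 1 then - b (\<rho> + 2 + l)
     else if l = k + 1 then 1 else 0)"

definition G_vec :: "nat \<Rightarrow> nat \<Rightarrow> real vec" where
  "G_vec r \<rho> = unit_vec (r - \<rho>) (r - \<rho> - 1)"

definition outer :: "real vec \<Rightarrow> real vec \<Rightarrow> real mat" where
  "outer v w = mat (dim_vec v) (dim_vec w) (\<lambda>(k, l). v $ k * w $ l)"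

definition kron :: "real mat \<Rightarrow> real mat \<Rightarrow> real mat" where
  "kron X Y = mat (dim_row X * dim_row Y) (dim_col X * dim_col Y) (\<lambda>(k, l).
     X $$ (k div dim_row Y, l div dim_col Y) * Y $$ (k mod dim_row Y, l mod dim_col Y))"

definition psd_sqrt :: "real mat \<Rightarrow> real mat \<Rightarrow> bool" where
  "psd_sqrt Q R \<longleftrightarrow> R \<in> carrier_mat (dim_row Q) (dim_row Q) \<and> transpose_mat R = R \<and>
     (\<forall>v\<in>carrier_vec (dim_row Q). 0 \<le> v \<bullet> (R *\<^sub>v v)) \<and> R * R = Q"

definition cspectrum :: "real mat \<Rightarrow> complex set" where
  "cspectrum M = spectrum (map_mat complex_of_real M)"

text \<open>
  An eigenvalue of smallest non-zero real part. A complex conjugate pair may attain it, so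
  only \<open>Re (lambda_min M)\<close> is determined by \<open>M\<close>.
\<close>

definition lambda_min :: "real mat \<Rightarrow> complex" where
  "lambda_min M = (SOME \<epsilon>. \<epsilon> \<in> cspectrum M \<and> Re \<epsilon> \<noteq> 0 \<and>
     (\<forall>\<kappa>\<in>cspectrum M. Re \<kappa> \<noteq> 0 \<longrightarrow> Re \<epsilon> \<le> Re \<kappa>))"

definition consensus_speed :: "real mat \<Rightarrow> real" where
  "consensus_speed M = Min {\<bar>Re \<epsilon>\<bar> | \<epsilon>. \<epsilon> \<in> cspectrum M \<and> Re \<epsilon> \<noteq> 0}"

definition observability_mat :: "real mat \<Rightarrow> real mat \<Rightarrow> real mat" where
  "observability_mat C A = mat (dim_row A * dim_row C) (dim_row A) (\<lambda>(k, l).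
     (C * A ^\<^sub>m (k div dim_row C)) $$ (k mod dim_row C, l))"

definition observable :: "real mat \<Rightarrow> real mat \<Rightarrow> bool" where
  "observable C A \<longleftrightarrow> vec_space.rank (dim_row A * dim_row C) (observability_mat C A) = dim_row A"

text \<open>
  No unobservable mode in the closed right half plane (Popov-Belevitch-Hautus form). The
  weight \<open>Q\<^sub>1 = q\<^sub>1 \<nu> \<nu>\<^sup>T\<close> with \<open>\<nu>\<^sup>T A = 0\<close> gives \<open>Q\<^sub>1\<^sup>1\<^sup>/\<^sup>2 A = 0\<close>, so the observability matrix has rank 1
  and observability fails as soon as \<open>A\<close> has more than one row. Detectability is what the
  linear-quadratic argument uses, and it does hold there.
\<close>

definition detectable :: "real mat \<Rightarrow> real mat \<Rightarrow> bool" where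
  "detectable C A \<longleftrightarrow> (\<forall>\<epsilon> v. eigenvector (map_mat complex_of_real A) v \<epsilon> \<and> 0 \<le> Re \<epsilon>
     \<longrightarrow> map_mat complex_of_real C *\<^sub>v v \<noteq> 0\<^sub>v (dim_row C))"

text \<open>\<open>(i, j) \<in> E\<close> means that agent \<open>i\<close> receives information from agent \<open>j\<close>.\<close>

definition weighted_digraph :: "nat \<Rightarrow> (nat \<times> nat) set \<Rightarrow> (nat \<Rightarrow> nat \<Rightarrow> real) \<Rightarrow> bool" where
  "weighted_digraph N E a \<longleftrightarrow> E \<subseteq> {..<N} \<times> {..<N} \<and>
     (\<forall>i<N. \<forall>j<N. if (i, j) \<in> E then a i j > 0 else a i j = 0)"

text \<open>Information flows against the orientation of the pairs in \<open>E\<close>.\<close>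

definition has_spanning_tree :: "nat \<Rightarrow> (nat \<times> nat) set \<Rightarrow> bool" where
  "has_spanning_tree N E \<longleftrightarrow> (\<exists>root<N. \<forall>j<N. (root, j) \<in> (E\<inverse>)\<^sup>*)"

definition laplacian :: "nat \<Rightarrow> (nat \<Rightarrow> nat \<Rightarrow> real) \<Rightarrow> real mat" where
  "laplacian N a = mat N N (\<lambda>(i, j). (if i = j then \<Sum>k<N. a i k else 0) - a i j)"

definition xi_vec :: "agent \<Rightarrow> nat \<Rightarrow> (nat \<Rightarrow> real) \<Rightarrow> real \<Rightarrow> real vec" where
  "xi_vec S \<rho> x u = vec (\<rho> + 1) (xi S \<rho> (aug (sdim S) x u))"

definition zeta :: "agent \<Rightarrow> nat \<Rightarrow> (nat \<Rightarrow> real) \<Rightarrow> real \<Rightarrow> real vec \<Rightarrow> real vec" where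
  "zeta S \<rho> x u \<phi> = xi_vec S \<rho> x u @\<^sub>v \<phi>"

definition control_w :: "agent \<Rightarrow> nat \<Rightarrow> (nat \<Rightarrow> (nat \<Rightarrow> real) \<Rightarrow> real) \<Rightarrow> nat \<Rightarrow> (nat \<Rightarrow> real) \<Rightarrow>
    (nat \<Rightarrow> real) \<Rightarrow> real \<Rightarrow> real vec \<Rightarrow> real \<Rightarrow> real" where
  "control_w S \<rho> \<psi> r b x u \<phi> v =
     (let z = aug (sdim S) x u;
          \<xi> = xi S \<rho> z;
          \<eta> = eta S \<rho> \<psi> z;
          \<alpha> = nf_alpha S \<rho> \<psi> \<xi> \<eta>;
          \<beta> = nf_beta S \<rho> \<psi> \<xi> \<eta>
      in if \<rho> < r then ((1 / \<beta>) \<cdot>\<^sub>v unit_vec (r - \<rho>) 0) \<bullet> \<phi> - \<alpha> / \<beta>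
         else (1 / \<beta>) * (- \<alpha> - (\<Sum>k=2..r + 1. b k * \<xi> (k - 1)) + v))"

text \<open>
  A trajectory on \<open>[0, \<infinity>)\<close> of one agent with its dynamic controller, driven by \<open>v\<close>. For
  \<open>\<rho> = r\<close> the controller state \<open>\<phi>\<close> has dimension 0.
\<close>

definition controlled_agent :: "agent \<Rightarrow> nat \<Rightarrow> (nat \<Rightarrow> (nat \<Rightarrow> real) \<Rightarrow> real) \<Rightarrow> nat \<Rightarrow>
    (nat \<Rightarrow> real) \<Rightarrow> (real \<Rightarrow> nat \<Rightarrow> real) \<Rightarrow> (real \<Rightarrow> real) \<Rightarrow> (real \<Rightarrow> real vec) \<Rightarrow>
    (real \<Rightarrow> real) \<Rightarrow> bool" where
  "controlled_agent S \<rho> \<psi> r b x u \<phi> v \<longleftrightarrow> (\<forall>t\<ge>0.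
     x t \<in> Rn (sdim S) \<and> \<phi> t \<in> carrier_vec (r - \<rho>) \<and>
     (\<forall>k<sdim S. ((\<lambda>s. x s k) has_real_derivative dyn S (x t) (u t) k) (at t within {0..})) \<and>
     (u has_real_derivative control_w S \<rho> \<psi> r b (x t) (u t) (\<phi> t) (v t)) (at t within {0..}) \<and>
     (\<forall>k<r - \<rho>. ((\<lambda>s. \<phi> s $ k) has_real_derivative
        (D_mat r \<rho> b *\<^sub>v xi_vec S \<rho> (x t) (u t) + E_mat r \<rho> b *\<^sub>v \<phi> t
          + v t \<cdot>\<^sub>v G_vec r \<rho>) $ k) (at t within {0..})))"

text \<open>\<open>c\<close> is the gain of the rank-1 cooperative inputs; \<open>Z i\<close> is the extended state of agent \<open>i\<close>.\<close>

definition cooperative_input :: "(nat \<times> nat) set \<Rightarrow> (nat \<Rightarrow> nat \<Rightarrow> real) \<Rightarrow> nat \<Rightarrow> real \<Rightarrow>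
    real vec \<Rightarrow> (nat \<Rightarrow> real vec) \<Rightarrow> nat \<Rightarrow> real" where
  "cooperative_input E a r c \<nu> Z i =
     - c * (\<nu> \<bullet> vec (r + 1) (\<lambda>k. \<Sum>j\<in>{j. (i, j) \<in> E}. a i j * (Z i $ k - Z j $ k)))"

definition closed_loop :: "nat \<Rightarrow> (nat \<Rightarrow> agent) \<Rightarrow> (nat \<Rightarrow> nat) \<Rightarrow>
    (nat \<Rightarrow> nat \<Rightarrow> (nat \<Rightarrow> real) \<Rightarrow> real) \<Rightarrow> nat \<Rightarrow> (nat \<Rightarrow> real) \<Rightarrow> (nat \<times> nat) set \<Rightarrow>
    (nat \<Rightarrow> nat \<Rightarrow> real) \<Rightarrow> real \<Rightarrow> real vec \<Rightarrow> (nat \<Rightarrow> real \<Rightarrow> nat \<Rightarrow> real) \<Rightarrow>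
    (nat \<Rightarrow> real \<Rightarrow> real) \<Rightarrow> (nat \<Rightarrow> real \<Rightarrow> real vec) \<Rightarrow> bool" where
  "closed_loop N S \<rho> \<psi> r b E a c \<nu> x u \<phi> \<longleftrightarrow>
     (\<forall>i<N. controlled_agent (S i) (\<rho> i) (\<psi> i) r b (x i) (u i) (\<phi> i)
        (\<lambda>t. cooperative_input E a r c \<nu>
           (\<lambda>j. zeta (S j) (\<rho> j) (x j t) (u j t) (\<phi> j t)) i))"

definition closed_loop_mat :: "nat \<Rightarrow> (nat \<Rightarrow> nat \<Rightarrow> real) \<Rightarrow> nat \<Rightarrow> (nat \<Rightarrow> real) \<Rightarrow> real \<Rightarrow>
    real vec \<Rightarrow> real mat" where
  "closed_loop_mat N a r b c \<nu> =
     kron (1\<^sub>m N) (A_mat r b) - c \<cdot>\<^sub>m kron (laplacian N a) (outer (B_vec r) \<nu>)"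

end

theory Submission
  imports Defs
begin

text \<open>
  The controllers turn every agent into \<open>\<zeta>' = A \<zeta> + B v\<close>, by the chain rule along a trajectory of the
  augmented agent. Since \<open>\<nu>\<^sup>T A = 0\<close>, the scalars \<open>w\<^sub>i = \<nu>\<^sup>T \<zeta>\<^sub>i\<close> satisfy \<open>w' = - \<kappa> L w\<close> with
  \<open>\<kappa> = c B\<^sup>T \<nu>\<close>, where \<open>c\<close> is the gain of the cooperative inputs, so they reach consensus by the
  spanning tree. On the other hand \<open>w\<^sub>i\<close> is a multiple of \<open>P(d/dt) y\<^sub>i\<close>, where \<open>s P(s)\<close> is the
  characteristic polynomial of \<open>A\<close>. As \<open>P\<close> is Hurwitz, the differences \<open>y\<^sub>i - y\<^sub>j\<close> tend to 0 as well.
  The same left null vector splits the closed-loop spectrum: apart from the imaginary axis it consists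
  of \<open>- \<kappa> \<lambda>\<close> for the eigenvalues \<open>\<lambda>\<close> of \<open>L\<close>, and of the eigenvalues of \<open>A\<close>.
\<close>

section \<open>Decay of linear differential equations\<close>

text \<open>The closed-loop matrix keeps the eigenvalue 0, which belongs to agreement, so its
  spectrum alone does not yield convergence; decay in time and the spectral identity are proved
  separately. On the time side the Laplacian flow is replaced by the disagreement with a root of the
  spanning tree, whose system matrix is Hurwitz. The Laplacian may fail to be diagonalizable, so
  everything is reduced to one scalar estimate with a forcing term that merely tends to 0. It is
  used along the diagonal of a triangular form, and once more for every root of \<open>P\<close>.
  That \<open>P\<close> is Hurwitz combines two hypotheses: its roots are real and non-positive, and
  \<open>P(0) = b 2\<close> is nonzero because 0 is a simple root of the characteristic polynomial
  of \<open>A\<close>. The spectral identity is stated off the imaginary axis because only nonzero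
  real parts enter the consensus speed.\<close>

lemma linear_ode_decay:
  fixes e g :: "real \<Rightarrow> complex"
  assumes l: "Re l < 0"
    and e: "\<And>t. t \<ge> 0 \<Longrightarrow> (e has_vector_derivative (l * e t + g t)) (at t within {0..})"
    and g: "(g \<longlongrightarrow> 0) at_top"
  shows "(e \<longlongrightarrow> 0) at_top"
proof (rule tendstoI)
  fix \<epsilon> :: real assume \<epsilon>: "\<epsilon> > 0"
  define \<sigma> where "\<sigma> = - Re l"
  have \<sigma>: "\<sigma> > 0" using l by (simp add: \<sigma>_def)
  \<comment> \<open>A forcing term that stays below \<delta> contributes at most
    \<open>\<delta> / \<sigma>\<close> to \<open>e\<close>. This choice makes that half of
    \<epsilon> and leaves the other half to the transient.\<close>
  define \<delta> where "\<delta> = \<epsilon> * \<sigma> / 2"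
  have \<delta>: "\<delta> > 0" using \<epsilon> \<sigma> by (simp add: \<delta>_def)
  obtain T0 where T0: "\<And>t. t \<ge> T0 \<Longrightarrow> norm (g t) < \<delta>"
    using tendstoD[OF g \<delta>] by (auto simp: eventually_at_top_linorder)
  define T where "T = max T0 0"
  \<comment> \<open>Integrating factor: in the derivative of \<open>h\<close> the homogeneous term
    cancels. The increment of \<open>h\<close> is then compared with that of the majorant
    \<open>\<delta> / \<sigma> * exp (\<sigma> * t)\<close>, which replaces the integral of the
    variation-of-constants formula.\<close>
  define h where "h = (\<lambda>s. exp (- l * of_real s) * e s)"
  have h': "(h has_vector_derivative exp (- l * of_real s) * g s) (at s within {0..})" if "s \<ge> 0" for s
  proof -
    have "((\<lambda>z. exp (- l * z)) has_field_derivative (- l * exp (- l * of_real s))) (at (of_real s))"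
      by (auto intro!: derivative_eq_intros)
    then have 1: "((\<lambda>s. exp (- l * of_real s)) has_vector_derivative (- l * exp (- l * of_real s))) (at s within {0..})"
      by (rule has_vector_derivative_real_field)
    show ?thesis unfolding h_def
      using has_vector_derivative_mult[OF 1 e[OF that]]
      by (rule has_vector_derivative_eq_rhs) (simp add: algebra_simps)
  qed
  have bound: "norm (h t - h T) \<le> \<delta> / \<sigma> * exp (\<sigma> * t) - \<delta> / \<sigma> * exp (\<sigma> * T)" if t: "t > T" for t
  proof (rule differentiable_bound_general[OF t])
    have T: "T \<ge> 0" by (simp add: T_def)
    show "continuous_on {T..t} h"
      unfolding continuous_on_eq_continuous_within
    proof
      fix x assume x: "x \<in> {T..t}"
      then have "continuous (at x within {0..}) h"
        using h'[of x] T has_vector_derivative_continuous by fastforce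
      then show "continuous (at x within {T..t}) h"
        by (rule continuous_within_subset) (use T in auto)
    qed
    show "continuous_on {T..t} (\<lambda>t. \<delta> / \<sigma> * exp (\<sigma> * t))"
      by (intro continuous_intros)
    fix x assume x: "T < x" "x < t"
    have x0: "x > 0" using x T by simp
    have "at x within {0..} = at x"
      using x0 by (intro at_within_interior) (simp add: interior_real_atLeast)
    then show "(h has_vector_derivative exp (- l * of_real x) * g x) (at x)"
      using h'[of x] x0 by simp
    show "((\<lambda>t. \<delta> / \<sigma> * exp (\<sigma> * t)) has_vector_derivative \<delta> * exp (\<sigma> * x)) (at x)"
      using \<sigma> by (auto intro!: derivative_eq_intros simp: has_real_derivative_iff_has_vector_derivative[symmetric])
    have "norm (g x) \<le> \<delta>" using T0[of x] x by (simp add: T_def)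
    then show "norm (exp (- l * of_real x) * g x) \<le> \<delta> * exp (\<sigma> * x)"
      by (simp add: norm_mult \<sigma>_def)
  qed
  have e_bound: "norm (e t) \<le> exp (- \<sigma> * t) * norm (h T) + \<delta> / \<sigma>" if t: "t > T" for t
  proof -
    have "norm (h t) \<le> norm (h T) + \<delta> / \<sigma> * exp (\<sigma> * t)"
      using bound[OF t] norm_triangle_ineq2[of "h t" "h T"] \<delta> \<sigma>
      by (smt (verit) divide_pos_pos exp_gt_zero mult_pos_pos)
    moreover have "norm (h t) = exp (\<sigma> * t) * norm (e t)"
      by (simp add: h_def norm_mult \<sigma>_def)
    ultimately have "exp (- \<sigma> * t) * (exp (\<sigma> * t) * norm (e t))
        \<le> exp (- \<sigma> * t) * (norm (h T) + \<delta> / \<sigma> * exp (\<sigma> * t))"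
      by (intro mult_left_mono) auto
    moreover have "exp (- \<sigma> * t) * (exp (\<sigma> * t) * norm (e t)) = norm (e t)"
      by (simp flip: exp_add mult.assoc)
    moreover have "exp (- \<sigma> * t) * (norm (h T) + \<delta> / \<sigma> * exp (\<sigma> * t))
        = exp (- \<sigma> * t) * norm (h T) + \<delta> / \<sigma> * (exp (- \<sigma> * t) * exp (\<sigma> * t))"
      by (simp add: algebra_simps)
    moreover have "exp (- \<sigma> * t) * exp (\<sigma> * t) = 1"
      by (simp flip: exp_add)
    ultimately show ?thesis by (simp only: mult_1_right)
  qed
  have "((\<lambda>t. exp (- \<sigma> * t) * norm (h T)) \<longlongrightarrow> 0 * norm (h T)) at_top"
  proof (intro tendsto_intros)
    have "filterlim (\<lambda>t. \<sigma> * t) at_top at_top"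
      by (rule filterlim_tendsto_pos_mult_at_top[OF tendsto_const \<sigma> filterlim_ident])
    then have "filterlim (\<lambda>t. - (\<sigma> * t)) at_bot at_top"
      by (simp add: filterlim_uminus_at_bot)
    then show "((\<lambda>t. exp (- \<sigma> * t)) \<longlongrightarrow> 0) at_top"
      by (auto intro: filterlim_compose[OF exp_at_bot])
  qed
  then have "eventually (\<lambda>t. exp (- \<sigma> * t) * norm (h T) < \<epsilon> / 2) at_top"
    using \<epsilon> by (intro order_tendstoD(2)) auto
  moreover have "eventually (\<lambda>t. t > T) at_top" by (rule eventually_gt_at_top)
  ultimately show "eventually (\<lambda>t. dist (e t) 0 < \<epsilon>) at_top"
  proof eventually_elim
    case (elim t)
    have "\<delta> / \<sigma> = \<epsilon> / 2" using \<sigma> by (simp add: \<delta>_def)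
    then show ?case using e_bound[OF elim(2)] elim(1) by simp
  qed
qed

text \<open>Back substitution: row \<open>k\<close> is a scalar equation whose forcing term collects
  the components with larger index, and these tend to 0 by induction on
  \<open>n - k\<close>.\<close>

lemma upper_triangular_ode_decay:
  fixes T :: "complex mat" and e :: "nat \<Rightarrow> real \<Rightarrow> complex"
  assumes T: "T \<in> carrier_mat n n" "upper_triangular T"
    and diag: "\<And>k. k < n \<Longrightarrow> Re (T $$ (k, k)) < 0"
    and e: "\<And>k t. k < n \<Longrightarrow> t \<ge> 0 \<Longrightarrow>
      (e k has_vector_derivative (\<Sum>l<n. T $$ (k, l) * e l t)) (at t within {0..})"
    and "k < n"
  shows "(e k \<longlongrightarrow> 0) at_top"
  using \<open>k < n\<close>
proof (induction "n - k" arbitrary: k rule: less_induct)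
  case less
  define g where "g = (\<lambda>t. \<Sum>l\<in>{k<..<n}. T $$ (k, l) * e l t)"
  have split: "(\<Sum>l<n. T $$ (k, l) * e l t) = T $$ (k, k) * e k t + g t" for t
  proof -
    have "(\<Sum>l<n. T $$ (k, l) * e l t) = (\<Sum>l\<in>{k..<n}. T $$ (k, l) * e l t)"
      using T less.prems by (intro sum.mono_neutral_right) (auto simp: upper_triangular_def)
    also have "{k..<n} = insert k {k<..<n}" using less.prems by auto
    finally show ?thesis by (simp add: g_def)
  qed
  have "(g \<longlongrightarrow> (\<Sum>l\<in>{k<..<n}. T $$ (k, l) * 0)) at_top"
    unfolding g_def by (intro tendsto_intros less.hyps) auto
  then show ?case
    using linear_ode_decay[OF diag[OF less.prems], of "e k" g] e[OF less.prems] split by simp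
qed

text \<open>The diagonal of the triangular factor lists the roots of the characteristic polynomial,
  so every diagonal entry is an eigenvalue.\<close>

lemma complex_schur_form:
  fixes M :: "complex mat"
  assumes M: "M \<in> carrier_mat n n"
  obtains T P Q where "T \<in> carrier_mat n n" "P \<in> carrier_mat n n" "Q \<in> carrier_mat n n"
    and "P * Q = 1\<^sub>m n" "Q * P = 1\<^sub>m n" "M = P * T * Q"
    and "upper_triangular T" "\<And>k. k < n \<Longrightarrow> eigenvalue M (T $$ (k, k))"
proof -
  obtain es where es: "char_poly M = (\<Prod>a\<leftarrow>es. [:- a, 1:])"
    using char_poly_factorized[OF M] by blast
  obtain T P Q where dec: "schur_decomposition M es = (T, P, Q)"
    by (metis prod_cases3)
  have sim: "similar_mat_wit M T P Q" and ut: "upper_triangular T" and dg: "diag_mat T = es"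
    using schur_decomposition[OF M es dec] by auto
  note simD = similar_mat_witD2[OF M sim]
  have "eigenvalue M (T $$ (k, k))" if "k < n" for k
  proof -
    have "T $$ (k, k) \<in> set es" using that simD(5) dg by (auto simp: diag_mat_def)
    then have "poly (char_poly M) (T $$ (k, k)) = 0"
      unfolding es by (simp add: poly_prod_list prod_list_zero_iff)
    then show ?thesis by (simp add: eigenvalue_root_char_poly[OF M])
  qed
  with simD ut show ?thesis using that by blast
qed

text \<open>A Schur decomposition reduces the claim to a cascade of scalar equations.\<close>

lemma hurwitz_ode_decay:
  fixes M :: "complex mat" and x :: "nat \<Rightarrow> real \<Rightarrow> complex"
  assumes M: "M \<in> carrier_mat n n"
    and ev: "\<And>\<epsilon>. eigenvalue M \<epsilon> \<Longrightarrow> Re \<epsilon> < 0"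
    and x: "\<And>k t. k < n \<Longrightarrow> t \<ge> 0 \<Longrightarrow>
      (x k has_vector_derivative (\<Sum>l<n. M $$ (k, l) * x l t)) (at t within {0..})"
    and k: "k < n"
  shows "(x k \<longlongrightarrow> 0) at_top"
proof -
  obtain T P Q where carr: "T \<in> carrier_mat n n" "P \<in> carrier_mat n n" "Q \<in> carrier_mat n n"
    and PQ: "P * Q = 1\<^sub>m n" and QP: "Q * P = 1\<^sub>m n" and MT: "M = P * T * Q"
    and ut: "upper_triangular T" and T_ev: "\<And>k. k < n \<Longrightarrow> eigenvalue M (T $$ (k, k))"
    using complex_schur_form[OF M] by blast
  have "Q * M = (Q * P) * T * Q"
    unfolding MT using carr by (simp add: assoc_mult_mat[of _ n n _ n _ n])
  then have QM: "Q * M = T * Q" using carr by (simp add: QP)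
  \<comment> \<open>Associativity of the action on a family of functions; it turns
    \<open>Q * M = T * Q\<close> into an equation for the transformed components.\<close>
  have mult: "(\<Sum>l<n. A $$ (i, l) * (\<Sum>m<n. B $$ (l, m) * y m)) = (\<Sum>m<n. (A * B) $$ (i, m) * y m)"
    if "A \<in> carrier_mat n n" "B \<in> carrier_mat n n" "i < n"
    for A B :: "complex mat" and i and y :: "nat \<Rightarrow> complex"
  proof -
    have "(\<Sum>l<n. A $$ (i, l) * (\<Sum>m<n. B $$ (l, m) * y m))
        = (\<Sum>m<n. \<Sum>l<n. A $$ (i, l) * B $$ (l, m) * y m)"
      by (simp only: sum_distrib_left mult.assoc, rule sum.swap)
    also have "\<dots> = (\<Sum>m<n. (A * B) $$ (i, m) * y m)"
      using that by (intro sum.cong) (auto simp: scalar_prod_def lessThan_atLeast0 sum_distrib_right)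
    finally show ?thesis .
  qed
  define e where "e = (\<lambda>k t. \<Sum>l<n. Q $$ (k, l) * x l t)"
  have e': "(e k has_vector_derivative (\<Sum>l<n. T $$ (k, l) * e l t)) (at t within {0..})"
    if k: "k < n" and t: "t \<ge> 0" for k t
  proof -
    have "(e k has_vector_derivative (\<Sum>l<n. Q $$ (k, l) * (\<Sum>m<n. M $$ (l, m) * x m t))) (at t within {0..})"
      unfolding e_def using t by (intro has_vector_derivative_sum has_vector_derivative_mult_right x) auto
    moreover have "(\<Sum>l<n. Q $$ (k, l) * (\<Sum>m<n. M $$ (l, m) * x m t))
        = (\<Sum>l<n. T $$ (k, l) * e l t)"
      unfolding e_def using k carr M by (simp add: mult QM)
    ultimately show ?thesis by simp
  qed
  have dec_e: "(e l \<longlongrightarrow> 0) at_top" if "l < n" for l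
    by (rule upper_triangular_ode_decay[OF carr(1) ut ev[OF T_ev] e' that])
  have "x k = (\<lambda>t. \<Sum>l<n. P $$ (k, l) * e l t)"
  proof
    fix t
    have "(\<Sum>l<n. P $$ (k, l) * e l t) = (\<Sum>m<n. (P * Q) $$ (k, m) * x m t)"
      unfolding e_def using k carr by (simp add: mult)
    also have "\<dots> = x k t" using k by (simp add: PQ if_distrib if_distribR sum.delta cong: if_cong)
    finally show "x k t = (\<Sum>l<n. P $$ (k, l) * e l t)" by simp
  qed
  moreover have "((\<lambda>t. \<Sum>l<n. P $$ (k, l) * e l t) \<longlongrightarrow> (\<Sum>l<n. P $$ (k, l) * 0)) at_top"
    by (intro tendsto_intros dec_e) auto
  ultimately show ?thesis by simp
qed

text \<open>Here \<open>d k\<close> stands for the derivative of \<open>d 0\<close> of order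
  \<open>k\<close>, so the last hypothesis says that the product of the operators
  \<open>d/dt - z\<close> sends \<open>d 0\<close> to a function that tends to 0. The induction
  peels off one factor: \<open>e = d' - z d\<close> meets the hypotheses for the remaining factors,
  and \<open>d 0\<close> then solves a scalar equation with forcing term \<open>e 0\<close>.\<close>

lemma factored_ode_decay:
  fixes d :: "nat \<Rightarrow> real \<Rightarrow> complex"
  assumes "\<And>z. z \<in> set zs \<Longrightarrow> Re z < 0"
    and "\<And>k t. k < length zs \<Longrightarrow> t \<ge> 0 \<Longrightarrow> (d k has_vector_derivative d (Suc k) t) (at t within {0..})"
    and "((\<lambda>t. \<Sum>k\<le>length zs. coeff (\<Prod>z\<leftarrow>zs. [:- z, 1:]) k * d k t) \<longlongrightarrow> 0) at_top"
  shows "(d 0 \<longlongrightarrow> 0) at_top"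
  using assms
proof (induction zs arbitrary: d)
  case Nil
  then show ?case by simp
next
  case (Cons z zs)
  define p where "p = (\<Prod>z\<leftarrow>zs. [:- z, 1:])"
  define e where "e = (\<lambda>k t. d (Suc k) t - z * d k t)"
  have deg: "degree p = length zs"
    unfolding p_def using degree_linear_factors[of uminus zs] by simp
  have "(e 0 \<longlongrightarrow> 0) at_top"
  proof (rule Cons.IH)
    show "\<And>z. z \<in> set zs \<Longrightarrow> Re z < 0" using Cons.prems(1) by simp
    show "(e k has_vector_derivative e (Suc k) t) (at t within {0..})"
      if "k < length zs" "t \<ge> 0" for k t
      unfolding e_def using that
      by (intro has_vector_derivative_diff has_vector_derivative_mult_right Cons.prems(2)) auto
    \<comment> \<open>Applying \<open>p\<close> to \<open>d' - z d\<close> is applying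
      \<open>[:- z, 1:] * p\<close> to \<open>d\<close>: the factor \<open>X\<close> shifts the
      coefficients by one, and the extra coefficient of \<open>z p\<close> at the top vanishes by
      the degree of \<open>p\<close>.\<close>
    have "(\<Sum>k\<le>length zs. coeff p k * e k t) =
        (\<Sum>k\<le>length (z # zs). coeff ([:- z, 1:] * p) k * d k t)" for t
    proof -
      let ?n = "length zs"
      have c: "coeff ([:- z, 1:] * p) k = (case k of 0 \<Rightarrow> 0 | Suc m \<Rightarrow> coeff p m) - z * coeff p k" for k
        by (simp add: coeff_pCons split: nat.split)
      have "(\<Sum>k\<le>Suc ?n. coeff ([:- z, 1:] * p) k * d k t)
          = (\<Sum>k\<le>Suc ?n. (case k of 0 \<Rightarrow> 0 | Suc m \<Rightarrow> coeff p m) * d k t) - (\<Sum>k\<le>Suc ?n. z * coeff p k * d k t)"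
        by (simp only: c left_diff_distrib sum_subtractf)
      also have "(\<Sum>k\<le>Suc ?n. (case k of 0 \<Rightarrow> 0 | Suc m \<Rightarrow> coeff p m) * d k t) = (\<Sum>k\<le>?n. coeff p k * d (Suc k) t)"
        by (subst sum.atMost_Suc_shift) simp
      also have "(\<Sum>k\<le>Suc ?n. z * coeff p k * d k t) = (\<Sum>k\<le>?n. z * coeff p k * d k t)"
        using deg by (simp add: coeff_eq_0)
      finally show ?thesis
        by (simp add: e_def sum_subtractf[symmetric] algebra_simps)
    qed
    then show "((\<lambda>t. \<Sum>k\<le>length zs. coeff (\<Prod>z\<leftarrow>zs. [:- z, 1:]) k * e k t) \<longlongrightarrow> 0) at_top"
      using Cons.prems(3) by (simp add: p_def)
  qed
  moreover have "(d 0 has_vector_derivative z * d 0 t + e 0 t) (at t within {0..})" if "t \<ge> 0" for t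
    using Cons.prems(2)[of 0 t] that by (simp add: e_def)
  ultimately show ?case
    using linear_ode_decay[of z "d 0" "e 0"] Cons.prems(1) by simp
qed

section \<open>Lie derivatives along trajectories\<close>

lemma Rn_upd: "x \<in> Rn n \<Longrightarrow> k < n \<Longrightarrow> x(k := s) \<in> Rn n"
  by (auto simp: Rn_def)

text \<open>Partial derivatives at a point of \<open>Rn n\<close> move only coordinates below
  \<open>n\<close>, hence never leave \<open>Rn n\<close>.\<close>

lemma Ck_cong:
  assumes "\<And>x. x \<in> Rn n \<Longrightarrow> F x = G x"
  shows "Ck m n F \<longleftrightarrow> Ck m n G"
  using assms
proof (induction m arbitrary: F G)
  case 0
  then show ?case by (auto intro: continuous_on_cong)
next
  case (Suc m)
  have line: "(\<lambda>s. F (x(k := s))) = (\<lambda>s. G (x(k := s)))" if "x \<in> Rn n" "k < n" for x k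
    using Suc.prems Rn_upd[OF that] by auto
  then have "Ck m n (partial k F) \<longleftrightarrow> Ck m n (partial k G)" if "k < n" for k
    using that by (intro Suc.IH) (simp add: partial_def)
  moreover have "continuous_on (Rn n) F \<longleftrightarrow> continuous_on (Rn n) G"
    using Suc.prems by (intro continuous_on_cong) auto
  ultimately show ?case using line by (auto cong: conj_cong)
qed

lemma Ck_Suc_imp_Ck: "Ck (Suc m) n F \<Longrightarrow> Ck m n F"
  by (induction m arbitrary: F) auto

lemma Ck_mono:
  assumes "Ck m n F" "l \<le> m"
  shows "Ck l n F"
  using assms(2,1) by (induction m rule: dec_induct) (auto dest: Ck_Suc_imp_Ck simp del: Ck.simps)

lemma Ck_imp_continuous_on: "Ck m n F \<Longrightarrow> continuous_on (Rn n) F"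
  by (cases m) auto

lemma Ck_has_partial:
  assumes "Ck (Suc m) n F" "x \<in> Rn n" "k < n"
  shows "((\<lambda>s. F (x(k := s))) has_real_derivative partial k F x) (at (x k))"
  using assms unfolding partial_def by (simp add: DERIV_deriv_iff_field_differentiable)

lemma Ck_const: "Ck m n (\<lambda>x. c)"
proof (induction m arbitrary: c)
  case (Suc m)
  have "partial k (\<lambda>x. c) = (\<lambda>x. 0)" for k :: nat and c :: real
    by (simp add: partial_def fun_eq_iff)
  with Suc show ?case by simp
qed simp

text \<open>Lets the partial derivatives be given by formulas that are checked on
  \<open>Rn n\<close> only; elsewhere \<open>partial k F\<close> may differ from \<open>D k\<close>,
  which \<open>Ck_cong\<close> absorbs.\<close>

lemma Ck_SucI:
  assumes "continuous_on (Rn n) F"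
    and "\<And>k x. k < n \<Longrightarrow> x \<in> Rn n \<Longrightarrow> ((\<lambda>s. F (x(k := s))) has_real_derivative D k x) (at (x k))"
    and "\<And>k. k < n \<Longrightarrow> Ck m n (D k)"
  shows "Ck (Suc m) n F"
proof -
  have "Ck m n (partial k F)" if "k < n" for k
  proof -
    have "partial k F x = D k x" if "x \<in> Rn n" for x
      unfolding partial_def using assms(2)[OF \<open>k < n\<close> that] by (rule DERIV_imp_deriv)
    then show ?thesis using assms(3)[OF that] Ck_cong by blast
  qed
  then show ?thesis
    using assms(1,2) by (auto simp: field_differentiable_def)
qed

lemma Ck_add: "Ck m n F \<Longrightarrow> Ck m n G \<Longrightarrow> Ck m n (\<lambda>x. F x + G x)"
proof (induction m arbitrary: F G)
  case 0
  then show ?case by (auto intro: continuous_intros)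
next
  case (Suc m)
  show ?case
  proof (rule Ck_SucI)
    show "continuous_on (Rn n) (\<lambda>x. F x + G x)"
      using Suc.prems by (intro continuous_intros Ck_imp_continuous_on)
    show "((\<lambda>s. F (x(k := s)) + G (x(k := s))) has_real_derivative partial k F x + partial k G x) (at (x k))"
      if "k < n" "x \<in> Rn n" for k x
      using Ck_has_partial[OF Suc.prems(1) that(2,1)] Ck_has_partial[OF Suc.prems(2) that(2,1)]
      by (rule DERIV_add)
    show "Ck m n (\<lambda>x. partial k F x + partial k G x)" if "k < n" for k
      using Suc.prems that by (intro Suc.IH) auto
  qed
qed

lemma Ck_mult: "Ck m n F \<Longrightarrow> Ck m n G \<Longrightarrow> Ck m n (\<lambda>x. F x * G x)"
proof (induction m arbitrary: F G)
  case 0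
  then show ?case by (auto intro: continuous_intros)
next
  case (Suc m)
  show ?case
  proof (rule Ck_SucI)
    show "continuous_on (Rn n) (\<lambda>x. F x * G x)"
      using Suc.prems by (intro continuous_intros Ck_imp_continuous_on)
    show "((\<lambda>s. F (x(k := s)) * G (x(k := s))) has_real_derivative
        partial k F x * G x + partial k G x * F x) (at (x k))"
      if "k < n" "x \<in> Rn n" for k x
      by (rule DERIV_cong[OF DERIV_mult[OF Ck_has_partial[OF Suc.prems(1) that(2,1)]
            Ck_has_partial[OF Suc.prems(2) that(2,1)]]]) simp
    show "Ck m n (\<lambda>x. partial k F x * G x + partial k G x * F x)" if "k < n" for k
    proof (intro Ck_add Suc.IH)
      show "Ck m n F" "Ck m n G" by (rule Ck_Suc_imp_Ck, fact)+
    qed (use Suc.prems that in auto)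
  qed
qed

lemma Ck_sum: "finite I \<Longrightarrow> (\<And>i. i \<in> I \<Longrightarrow> Ck m n (F i)) \<Longrightarrow> Ck m n (\<lambda>x. \<Sum>i\<in>I. F i x)"
  by (induction I rule: finite_induct) (simp_all add: Ck_const Ck_add)

lemma Ck_lie:
  assumes "Ck (Suc m) n \<phi>" and "\<And>k. k < n \<Longrightarrow> Ck m n (\<lambda>z. F z k)"
  shows "Ck m n (lie n F \<phi>)"
  unfolding lie_def
proof (rule Ck_sum)
  show "Ck m n (\<lambda>z. partial k \<phi> z * F z k)" if "k \<in> {..<n}" for k
    using assms that by (intro Ck_mult) auto
qed simp

section \<open>The chain rule along a curve\<close>

lemma tendsto_coordinatewise:
  fixes f :: "'a \<Rightarrow> 'i \<Rightarrow> 'b::topological_space"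
  assumes "\<And>i. ((\<lambda>x. f x i) \<longlongrightarrow> l i) F"
  shows "(f \<longlongrightarrow> l) F"
proof -
  have "limitin (product_topology (\<lambda>i. euclidean) UNIV) f l F"
    using assms by (subst limitin_componentwise) auto
  then show ?thesis by (simp add: euclidean_product_topology)
qed

text \<open>The non-strict bound on \<open>c\<close> covers both orders of \<open>s\<close> and
  \<open>x k\<close> as well as \<open>s = x k\<close>; it is enough to push \<open>c\<close> to
  \<open>x k\<close> in the limit.\<close>

lemma partial_mean_value:
  assumes F: "Ck (Suc m) n F" and x: "x \<in> Rn n" and k: "k < n"
  obtains c where "\<bar>c - x k\<bar> \<le> \<bar>s - x k\<bar>"
    and "F (x(k := s)) - F x = partial k F (x(k := c)) * (s - x k)"
proof -
  have d: "((\<lambda>s. F (x(k := s))) has_real_derivative partial k F (x(k := c))) (at c)" for c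
    using Ck_has_partial[OF F Rn_upd[OF x k, of c] k] by simp
  have c: "continuous_on S (\<lambda>s. F (x(k := s)))" for S
    using d by (auto intro!: continuous_at_imp_continuous_on DERIV_isCont)
  consider "s = x k" | "s < x k" | "x k < s" by linarith
  then show ?thesis
  proof cases
    case 1
    then show ?thesis using that[of "x k"] by simp
  next
    case 2
    then obtain z where "s < z" "z < x k" "F (x(k := x k)) - F (x(k := s)) = (x k - s) * partial k F (x(k := z))"
      using MVT2[OF 2 d] by metis
    then show ?thesis using that[of z] 2 by (auto simp: algebra_simps)
  next
    case 3
    then obtain z where "x k < z" "z < s" "F (x(k := s)) - F (x(k := x k)) = (s - x k) * partial k F (x(k := z))"
      using MVT2[OF 3 d] by metis
    then show ?thesis using that[of z] 3 by (auto simp: algebra_simps)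
  qed
qed

text \<open>The increment of \<open>F\<close> is telescoped over the coordinates, with a mean value in each of them.\<close>

lemma Ck_chain_rule:
  assumes F: "Ck 1 n F"
    and z: "\<And>t. t \<in> S \<Longrightarrow> z t \<in> Rn n"
    and z': "\<And>k. k < n \<Longrightarrow> ((\<lambda>s. z s k) has_real_derivative z' k) (at t within S)"
    and t: "t \<in> S"
  shows "((\<lambda>s. F (z s)) has_real_derivative (\<Sum>k<n. partial k F (z t) * z' k)) (at t within S)"
proof -
  \<comment> \<open>\<open>p k s\<close> has the new coordinates below \<open>k\<close> and the old
    ones from \<open>k\<close> on, so consecutive points differ in one coordinate only.\<close>
  define p where "p = (\<lambda>k s i. if i < k then z s i else z t i)"
  have p_Rn: "p k s \<in> Rn n" if "s \<in> S" for k s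
    using z[OF that] z[OF t] by (auto simp: p_def Rn_def)
  have p_Suc: "p (Suc k) s = (p k s)(k := z s k)" for k s
    by (auto simp: p_def less_Suc_eq)
  have p_k: "p k s k = z t k" for k s by (simp add: p_def)
  have "\<exists>c. \<bar>c - z t k\<bar> \<le> \<bar>z s k - z t k\<bar> \<and>
      F (p (Suc k) s) - F (p k s) = partial k F ((p k s)(k := c)) * (z s k - z t k)"
    if "s \<in> S" "k < n" for k s
  proof -
    have "Ck (Suc 0) n F" using F by simp
    from partial_mean_value[OF this p_Rn[OF that(1)] that(2), of k "z s k"]
    show ?thesis unfolding p_Suc p_k by metis
  qed
  then obtain c where c: "\<And>s k. s \<in> S \<Longrightarrow> k < n \<Longrightarrow> \<bar>c s k - z t k\<bar> \<le> \<bar>z s k - z t k\<bar>"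
    and Fc: "\<And>s k. s \<in> S \<Longrightarrow> k < n \<Longrightarrow>
      F (p (Suc k) s) - F (p k s) = partial k F ((p k s)(k := c s k)) * (z s k - z t k)"
    by metis
  have tele: "F (z s) - F (z t) = (\<Sum>k<n. partial k F ((p k s)(k := c s k)) * (z s k - z t k))"
    if s: "s \<in> S" for s
  proof -
    have "p n s = z s" "p 0 s = z t"
      using z[OF s] z[OF t] by (auto simp: p_def Rn_def fun_eq_iff)
    then have "F (z s) - F (z t) = (\<Sum>k<n. F (p (Suc k) s) - F (p k s))"
      using sum_lessThan_telescope[of "\<lambda>k. F (p k s)" n] by simp
    also have "\<dots> = (\<Sum>k<n. partial k F ((p k s)(k := c s k)) * (z s k - z t k))"
      using s by (intro sum.cong) (auto simp: Fc)
    finally show ?thesis .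
  qed
  \<comment> \<open>The product topology asks for convergence in every coordinate. From index
    \<open>n\<close> on the components vanish throughout \<open>S\<close>, so they are constant
    there.\<close>
  have zc: "((\<lambda>s. z s i) \<longlongrightarrow> z t i) (at t within S)" for i
  proof (cases "i < n")
    case True
    then show ?thesis
      using z'[OF True] by (metis DERIV_continuous continuous_within)
  next
    case False
    have "eventually (\<lambda>s. z t i = z s i) (at t within S)"
      using z[OF t] z False by (auto simp: eventually_at_filter Rn_def)
    then show ?thesis by (rule Lim_transform_eventually[OF tendsto_const])
  qed
  have inS: "eventually (\<lambda>s. s \<in> S) (at t within S)"
    by (simp add: eventually_at_filter)
  have cc: "((\<lambda>s. c s k) \<longlongrightarrow> z t k) (at t within S)" if k: "k < n" for k
  proof -
    have "((\<lambda>s. c s k - z t k) \<longlongrightarrow> 0) (at t within S)"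
    proof (rule Lim_null_comparison)
      show "eventually (\<lambda>s. norm (c s k - z t k) \<le> \<bar>z s k - z t k\<bar>) (at t within S)"
        using inS by eventually_elim (simp add: c k)
      show "((\<lambda>s. \<bar>z s k - z t k\<bar>) \<longlongrightarrow> 0) (at t within S)"
        using zc[of k] by (simp add: tendsto_rabs_zero_iff LIM_zero_iff)
    qed
    then show ?thesis by (simp add: LIM_zero_iff)
  qed
  have lim: "((\<lambda>s. partial k F ((p k s)(k := c s k))) \<longlongrightarrow> partial k F (z t)) (at t within S)"
    if k: "k < n" for k
  proof -
    have "((\<lambda>s. (p k s)(k := c s k)) \<longlongrightarrow> z t) (at t within S)"
    proof (rule tendsto_coordinatewise)
      fix i
      show "((\<lambda>s. ((p k s)(k := c s k)) i) \<longlongrightarrow> z t i) (at t within S)"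
        using zc[of i] cc[OF k] by (cases "i = k"; cases "i < k") (simp_all add: p_def)
    qed
    moreover have "eventually (\<lambda>s. (p k s)(k := c s k) \<in> Rn n) (at t within S)"
      using inS by eventually_elim (intro Rn_upd p_Rn k)
    moreover have "continuous_on (Rn n) (partial k F)" using F k by simp
    ultimately show ?thesis using continuous_on_tendsto_compose z[OF t] by blast
  qed
  have "((\<lambda>s. (F (z s) - F (z t)) / (s - t)) \<longlongrightarrow> (\<Sum>k<n. partial k F (z t) * z' k)) (at t within S)"
  proof (rule Lim_transform_eventually)
    show "((\<lambda>s. \<Sum>k<n. partial k F ((p k s)(k := c s k)) * ((z s k - z t k) / (s - t)))
        \<longlongrightarrow> (\<Sum>k<n. partial k F (z t) * z' k)) (at t within S)"
      using lim z' by (intro tendsto_sum tendsto_mult) (auto simp: has_field_derivative_iff)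
    show "eventually (\<lambda>s. (\<Sum>k<n. partial k F ((p k s)(k := c s k)) * ((z s k - z t k) / (s - t)))
        = (F (z s) - F (z t)) / (s - t)) (at t within S)"
      using inS by eventually_elim (simp add: tele sum_divide_distrib)
  qed
  then show ?thesis by (simp add: has_field_derivative_iff)
qed

section \<open>Lie derivatives of the augmented agent\<close>

lemma state_part_Rn: "state_part n z \<in> Rn n"
  by (simp add: state_part_def Rn_def)

lemma aug_Rn: "aug n x u \<in> Rn (n + 1)"
  by (simp add: aug_def Rn_def)

lemma state_part_aug: "x \<in> Rn n \<Longrightarrow> state_part n (aug n x u) = x"
  by (auto simp: state_part_def aug_def Rn_def)

lemma aug_less: "k < n \<Longrightarrow> aug n x u k = x k" and aug_input: "aug n x u n = u"
  by (simp_all add: aug_def)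

lemma aug_upd: "k < n \<Longrightarrow> (aug n x u)(k := s) = aug n (x(k := s)) u" "(aug n x u)(n := s) = aug n x s"
  by (auto simp: aug_def)

text \<open>Partial derivatives in the state coordinates commute with the projection, and the one in
  the input coordinate vanishes. This carries the smoothness of the output over to
  \<open>aug_h\<close>.\<close>

lemma Ck_state_part: "Ck m n F \<Longrightarrow> Ck m (n + 1) (\<lambda>z. F (state_part n z))"
proof (induction m arbitrary: F)
  case 0
  have "continuous_on (Rn (n + 1)) (state_part n)"
  proof (rule continuous_on_coordinatewise_then_product)
    fix i
    have "continuous_on (Rn (n + 1)) (\<lambda>x::nat \<Rightarrow> real. x i)"
      by (rule continuous_on_product_then_coordinatewise[OF continuous_on_id])
    then show "continuous_on (Rn (n + 1)) (\<lambda>x. state_part n x i)"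
      by (cases "i < n") (simp_all add: state_part_def)
  qed
  with 0 show ?case
    by (auto intro!: continuous_on_compose2[of "Rn n" F] simp: state_part_Rn)
next
  case (Suc m)
  have 1: "continuous_on (Rn (n + 1)) (\<lambda>z. F (state_part n z))"
    using Suc.IH[of F] Ck_Suc_imp_Ck[OF Suc.prems] Ck_imp_continuous_on by blast
  define D where "D = (\<lambda>k z. if k < n then partial k F (state_part n z) else 0)"
  have "Ck (Suc m) (n + 1) (\<lambda>z. F (state_part n z))"
  proof (rule Ck_SucI[OF 1])
    fix k x assume k: "k < n + 1" and x: "x \<in> Rn (n + 1)"
    show "((\<lambda>s. F (state_part n (x(k := s)))) has_real_derivative D k x) (at (x k))"
    proof (cases "k < n")
      case True
      then have upd: "state_part n (x(k := s)) = (state_part n x)(k := s)" for s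
        by (auto simp: state_part_def)
      have "state_part n x k = x k" using True by (simp add: state_part_def)
      then show ?thesis
        using True Ck_has_partial[OF Suc.prems state_part_Rn True, of x]
        unfolding upd D_def by (simp only: if_True)
    next
      case False
      then have "state_part n (x(k := s)) = state_part n x" for s
        by (auto simp: state_part_def)
      then show ?thesis using False by (simp add: D_def)
    qed
  next
    fix k assume "k < n + 1"
    show "Ck m (n + 1) (D k)"
      using Suc.prems Suc.IH[of "partial k F"] Ck_const[of m "n + 1" 0]
      by (cases "k < n") (auto simp: D_def)
  qed
  then show ?case .
qed

text \<open>Each Lie derivative costs one order of smoothness. Up to order \<rho> at least
  \<open>Ck 1\<close> is left, as the chain rule requires.\<close>

lemma Ck_Lf_h:
  assumes S: "smooth_agent S \<rho>" and k: "k \<le> \<rho> + 1"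
  shows "Ck (\<rho> + 1 - k) (sdim S + 1) (Lf_h S k)"
  using k
proof (induction k)
  case 0
  have "aug_h S = (\<lambda>z. out S (state_part (sdim S) z))" by (simp add: aug_h_def fun_eq_iff)
  then show ?case using S Ck_state_part[of "\<rho> + 1" "sdim S" "out S"]
    by (simp add: Lf_h_def smooth_agent_def)
next
  case (Suc k)
  have "Ck (\<rho> - k) (sdim S + 1) (lie (sdim S + 1) (aug_f S) (Lf_h S k))"
  proof (rule Ck_lie)
    show "Ck (Suc (\<rho> - k)) (sdim S + 1) (Lf_h S k)"
      using Suc by (simp add: Suc_diff_le)
    fix j assume "j < sdim S + 1"
    then consider "j < sdim S" | "j = sdim S" by linarith
    then show "Ck (\<rho> - k) (sdim S + 1) (\<lambda>z. aug_f S z j)"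
    proof cases
      case 1
      then have "Ck \<rho> (sdim S + 1) (\<lambda>z. aug_f S z j)" using S by (simp add: smooth_agent_def)
      then show ?thesis by (rule Ck_mono) simp
    next
      case 2
      then show ?thesis by (simp add: aug_f_def Ck_const)
    qed
  qed
  then show ?case by (simp add: Lf_h_def)
qed

text \<open>The augmented field has component 0 in the input direction, so along it the input is a
  frozen parameter. This links the relative degree, phrased for the original agent, to the
  coordinates of the normal form.\<close>

lemma Lf_h_aug:
  assumes "x \<in> Rn (sdim S)"
  shows "Lf_h S k (aug (sdim S) x u) = (lie_state (sdim S) (dyn S) ^^ k) (\<lambda>x u. out S x) x u"
  using assms
proof (induction k arbitrary: x)
  case 0
  then show ?case by (simp add: Lf_h_def aug_h_def state_part_aug)
next
  case (Suc k)
  let ?n = "sdim S" let ?z = "aug (sdim S) x u"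
  let ?L = "(lie_state ?n (dyn S) ^^ k) (\<lambda>x u. out S x)"
  have "partial j (Lf_h S k) ?z = partial j (\<lambda>x'. ?L x' u) x" if j: "j < ?n" for j
    unfolding partial_def aug_upd(1)[OF j] aug_less[OF j] Suc.IH[OF Rn_upd[OF Suc.prems j]] ..
  then have "(\<Sum>j<?n. partial j (Lf_h S k) ?z * aug_f S ?z j) = (\<Sum>j<?n. partial j (\<lambda>x'. ?L x' u) x * dyn S x u j)"
    using Suc.prems by (intro sum.cong) (simp_all add: aug_f_def state_part_aug aug_input)
  then have "lie (?n + 1) (aug_f S) (Lf_h S k) ?z = lie_state ?n (dyn S) ?L x u"
    by (simp add: lie_def lie_state_def) (simp add: aug_f_def)
  then show ?case by (simp add: Lf_h_def)
qed

lemma lie_aug_g: "lie (sdim S + 1) (aug_g S) F z = partial (sdim S) F z"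
  by (simp add: lie_def aug_g_def)

text \<open>Translates the relative degree into the two facts that the control needs: the
  coefficient of the new input vanishes below order \<rho>, and at order \<rho> it is a divisor
  different from 0.\<close>

lemma lie_aug_g_Lf_h:
  assumes "x \<in> Rn (sdim S)"
  shows "lie (sdim S + 1) (aug_g S) (Lf_h S k) (aug (sdim S) x u) =
    deriv (\<lambda>u. (lie_state (sdim S) (dyn S) ^^ k) (\<lambda>x u. out S x) x u) u"
  unfolding lie_aug_g partial_def aug_upd(2) aug_input Lf_h_aug[OF assms] ..

text \<open>The output does not involve the input, so its derivative in the input is 0. This gives
  \<open>0 < r\<close> later, hence the existence of a nonzero eigenvalue of
  \<open>A_mat\<close>.\<close>

lemma relative_degree_pos:
  assumes "relative_degree S \<rho>"
  shows "0 < \<rho>"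
proof (rule ccontr)
  assume "\<not> 0 < \<rho>"
  then have "deriv (\<lambda>u::real. out S (\<lambda>_. 0)) 0 \<noteq> 0"
    using assms by (auto simp: relative_degree_def Rn_def)
  then show False by simp
qed

text \<open>The control evaluates \<alpha> and \<beta> through the inverse diffeomorphism at the
  current coordinates; this identifies the point with the augmented state itself.\<close>

lemma Phi_inv_Phi:
  assumes "normal_form S \<rho> \<psi>" "z \<in> Rn (sdim S + 1)"
  shows "Phi_inv S \<rho> \<psi> (xi S \<rho> z) (eta S \<rho> \<psi> z) = z"
  using assms unfolding Phi_inv_def Phi_def[symmetric]
  by (intro inv_into_f_f) (auto simp: normal_form_def bij_betw_def)

text \<open>The augmented trajectory has velocity \<open>aug_f + aug_g * w\<close>, and the chain
  rule is linear in the velocity.\<close>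

lemma Lf_h_has_derivative:
  assumes S: "smooth_agent S \<rho>" and k: "k \<le> \<rho>" and t: "t \<ge> 0"
    and x: "\<And>t. t \<ge> 0 \<Longrightarrow> x t \<in> Rn (sdim S)"
    and x': "\<And>k. k < sdim S \<Longrightarrow>
      ((\<lambda>s. x s k) has_real_derivative dyn S (x t) (u t) k) (at t within {0..})"
    and u': "(u has_real_derivative w) (at t within {0..})"
  shows "((\<lambda>s. Lf_h S k (aug (sdim S) (x s) (u s))) has_real_derivative
      Lf_h S (Suc k) (aug (sdim S) (x t) (u t)) +
      lie (sdim S + 1) (aug_g S) (Lf_h S k) (aug (sdim S) (x t) (u t)) * w) (at t within {0..})"
proof -
  let ?z = "\<lambda>s. aug (sdim S) (x s) (u s)"
  have C: "Ck 1 (sdim S + 1) (Lf_h S k)"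
    using Ck_mono[OF Ck_Lf_h[OF S, of k], of 1] k by simp
  have "((\<lambda>s. ?z s j) has_real_derivative aug_f S (?z t) j + aug_g S (?z t) j * w) (at t within {0..})"
    if "j < sdim S + 1" for j
  proof (cases "j < sdim S")
    case True
    then show ?thesis using x'[OF True] state_part_aug[OF x[OF t]]
      by (simp add: aug_f_def aug_g_def aug_less aug_input)
  next
    case False
    then have "j = sdim S" using that by simp
    then show ?thesis using u' by (simp add: aug_f_def aug_g_def aug_input)
  qed
  note z' = this
  have "((\<lambda>s. Lf_h S k (?z s)) has_real_derivative
      (\<Sum>j<sdim S + 1. partial j (Lf_h S k) (?z t) * (aug_f S (?z t) j + aug_g S (?z t) j * w))) (at t within {0..})"
    by (rule Ck_chain_rule[OF C _ z']) (simp_all only: aug_Rn t atLeast_iff)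
  moreover have "(\<Sum>j<sdim S + 1. partial j (Lf_h S k) (?z t) * (aug_f S (?z t) j + aug_g S (?z t) j * w))
      = lie (sdim S + 1) (aug_f S) (Lf_h S k) (?z t) + lie (sdim S + 1) (aug_g S) (Lf_h S k) (?z t) * w"
    unfolding lie_def sum_distrib_right sum.distrib[symmetric] by (rule sum.cong) (simp_all add: distrib_left mult.assoc)
  moreover have "Lf_h S (Suc k) = lie (sdim S + 1) (aug_f S) (Lf_h S k)" by (simp add: Lf_h_def)
  ultimately show ?thesis by simp
qed

lemma zeta_index:
  assumes "\<phi> \<in> carrier_vec (r - \<rho>)" "\<rho> \<le> r" "k < r + 1"
  shows "zeta S \<rho> x u \<phi> $ k = (if k \<le> \<rho> then Lf_h S k (aug (sdim S) x u) else \<phi> $ (k - \<rho> - 1))"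
  using assms by (auto simp: zeta_def xi_vec_def xi_def)

text \<open>The rows of \<open>\<zeta>' = A \<zeta> + B v\<close>, in a form that hides \<rho>.
  Below index \<rho> the Lie derivatives form a chain, as the input does not enter. At index \<rho>
  the control cancels \<alpha> and divides by \<beta>, which leaves the first controller state, or
  the closing row if \<open>\<rho> = r\<close>. Above \<rho> the controller itself continues the
  chain up to the closing row.\<close>

lemma zeta_has_derivative:
  assumes S: "smooth_agent S \<rho>" and rd: "relative_degree S \<rho>" and nf: "normal_form S \<rho> \<psi>"
    and \<rho>: "\<rho> \<le> r" and C: "controlled_agent S \<rho> \<psi> r b x u \<phi> v"
    and t: "t \<ge> 0" and k: "k < r + 1"
  defines "Z \<equiv> \<lambda>s. zeta S \<rho> (x s) (u s) (\<phi> s)"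
  shows "((\<lambda>s. Z s $ k) has_real_derivative
      (if k < r then Z t $ (k + 1) else (\<Sum>l=1..r. - b (l + 1) * Z t $ l) + v t)) (at t within {0..})"
proof -
  let ?z = "\<lambda>s. aug (sdim S) (x s) (u s)"
  let ?\<xi> = "xi S \<rho> (?z t)"
  define \<alpha> where "\<alpha> = Lf_h S (Suc \<rho>) (?z t)"
  define \<beta> where "\<beta> = lie (sdim S + 1) (aug_g S) (Lf_h S \<rho>) (?z t)"
  define w where "w = control_w S \<rho> \<psi> r b (x t) (u t) (\<phi> t) (v t)"
  have x: "x t \<in> Rn (sdim S)" and \<phi>: "\<phi> t \<in> carrier_vec (r - \<rho>)"
    and x': "\<And>k. k < sdim S \<Longrightarrow> ((\<lambda>s. x s k) has_real_derivative dyn S (x t) (u t) k) (at t within {0..})"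
    and \<phi>': "\<And>k. k < r - \<rho> \<Longrightarrow> ((\<lambda>s. \<phi> s $ k) has_real_derivative
        (D_mat r \<rho> b *\<^sub>v xi_vec S \<rho> (x t) (u t) + E_mat r \<rho> b *\<^sub>v \<phi> t
          + v t \<cdot>\<^sub>v G_vec r \<rho>) $ k) (at t within {0..})"
    if "t \<ge> 0" for t
    using C that by (auto simp: controlled_agent_def)
  have u': "(u has_real_derivative w) (at t within {0..})"
    using C t by (simp add: controlled_agent_def w_def)
  have Z: "Z s $ l = (if l \<le> \<rho> then Lf_h S l (?z s) else \<phi> s $ (l - \<rho> - 1))"
    if "s \<ge> 0" "l < r + 1" for s l
    unfolding Z_def by (rule zeta_index[OF \<phi>[OF that(1)] \<rho> that(2)])
  have \<beta>0: "\<beta> \<noteq> 0"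
    using rd x[OF t] lie_aug_g_Lf_h[OF x[OF t]] unfolding \<beta>_def relative_degree_def by simp
  have zero: "lie (sdim S + 1) (aug_g S) (Lf_h S l) (?z t) = 0" if "l < \<rho>" for l
    using rd x[OF t] lie_aug_g_Lf_h[OF x[OF t]] that unfolding relative_degree_def by simp
  have inv: "Phi_inv S \<rho> \<psi> ?\<xi> (eta S \<rho> \<psi> (?z t)) = ?z t"
    by (rule Phi_inv_Phi[OF nf aug_Rn])
  have w: "\<alpha> + \<beta> * w = (if \<rho> < r then \<phi> t $ 0 else (\<Sum>l=1..r. - b (l + 1) * Z t $ l) + v t)"
  proof (cases "\<rho> < r")
    case True
    then have "w = \<phi> t $ 0 / \<beta> - \<alpha> / \<beta>"
      using \<phi>[OF t] unfolding w_def control_w_def Let_def nf_alpha_def nf_beta_def inv \<alpha>_def \<beta>_def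
      by simp
    then show ?thesis using True \<beta>0 by (simp add: field_simps)
  next
    case False
    then have eq: "\<rho> = r" using \<rho> by simp
    have "w = (1 / \<beta>) * (- \<alpha> - (\<Sum>k=2..r + 1. b k * ?\<xi> (k - 1)) + v t)"
      using False unfolding w_def control_w_def Let_def nf_alpha_def nf_beta_def inv \<alpha>_def \<beta>_def
      by simp
    then have "\<alpha> + \<beta> * w = - (\<Sum>k=2..r + 1. b k * ?\<xi> (k - 1)) + v t"
      using \<beta>0 by simp
    also have "(\<Sum>k=2..r + 1. b k * ?\<xi> (k - 1)) = (\<Sum>l=1..r. b (l + 1) * ?\<xi> l)"
      by (rule sum.reindex_bij_witness[of _ "\<lambda>l. l + 1" "\<lambda>k. k - 1"]) auto
    also have "\<dots> = (\<Sum>l=1..r. b (l + 1) * Z t $ l)"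
      using t eq by (intro sum.cong) (auto simp: Z xi_def)
    finally show ?thesis using False by (simp add: sum_negf)
  qed
  have Lf: "((\<lambda>s. Lf_h S l (?z s)) has_real_derivative Lf_h S (Suc l) (?z t) +
      lie (sdim S + 1) (aug_g S) (Lf_h S l) (?z t) * w) (at t within {0..})" if "l \<le> \<rho>" for l
    by (rule Lf_h_has_derivative[OF S that t x x'[OF t] u'])
  \<comment> \<open>The block form of \<open>zeta\<close> is known for nonnegative times only, where
    the controller state has the right dimension. Derivatives within \<open>{0..}\<close> see
    nothing else.\<close>
  have transfer: "((\<lambda>s. Z s $ k) has_real_derivative d) (at t within {0..})"
    if "(f has_real_derivative d) (at t within {0..})" "\<And>s. s \<ge> 0 \<Longrightarrow> Z s $ k = f s" for f d
    by (rule has_field_derivative_transform_within[OF that(1), of 1]) (use that(2) t in auto)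
  consider "k < \<rho>" | "k = \<rho>" | "\<rho> < k" by linarith
  then show ?thesis
  proof cases
    case 1
    then have "((\<lambda>s. Z s $ k) has_real_derivative Lf_h S (Suc k) (?z t)) (at t within {0..})"
      using Lf[of k] zero[of k] k by (intro transfer) (auto simp: Z)
    then show ?thesis using 1 \<rho> t by (simp add: Z)
  next
    case 2
    then have "((\<lambda>s. Z s $ k) has_real_derivative \<alpha> + \<beta> * w) (at t within {0..})"
      using Lf[of \<rho>] k by (intro transfer) (auto simp: Z \<alpha>_def \<beta>_def)
    then show ?thesis using 2 \<rho> t by (auto simp: Z w)
  next
    case 3
    define m where "m = k - \<rho> - 1"
    have m: "m < r - \<rho>" using 3 k by (simp add: m_def)
    have d: "((\<lambda>s. Z s $ k) has_real_derivative
        (D_mat r \<rho> b *\<^sub>v xi_vec S \<rho> (x t) (u t)) $ m + (E_mat r \<rho> b *\<^sub>v \<phi> t) $ m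
          + v t * G_vec r \<rho> $ m) (at t within {0..})"
    proof (rule transfer)
      show "((\<lambda>s. \<phi> s $ m) has_real_derivative
        (D_mat r \<rho> b *\<^sub>v xi_vec S \<rho> (x t) (u t)) $ m + (E_mat r \<rho> b *\<^sub>v \<phi> t) $ m
          + v t * G_vec r \<rho> $ m) (at t within {0..})"
        using \<phi>'[OF t m] m by (simp add: D_mat_def E_mat_def G_vec_def)
      show "Z s $ k = \<phi> s $ m" if "s \<ge> 0" for s
        using 3 k that by (simp add: Z m_def)
    qed
    have D: "(D_mat r \<rho> b *\<^sub>v xi_vec S \<rho> (x t) (u t)) $ m
        = (\<Sum>l=0..<\<rho> + 1. (if m = r - \<rho> - 1 \<and> l \<noteq> 0 then - b (l + 1) else 0) * Lf_h S l (?z t))"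
      using m by (simp add: D_mat_def scalar_prod_def xi_vec_def xi_def)
    have E: "(E_mat r \<rho> b *\<^sub>v \<phi> t) $ m
        = (\<Sum>l=0..<r - \<rho>. (if m = r - \<rho> - 1 then - b (\<rho> + 2 + l) else if l = m + 1 then 1 else 0) * \<phi> t $ l)"
      using m \<phi>[OF t] by (simp add: E_mat_def scalar_prod_def)
    show ?thesis
    proof (cases "k < r")
      case True
      then have m': "m \<noteq> r - \<rho> - 1" "m + 1 < r - \<rho>" "k + 1 - \<rho> - 1 = m + 1" using 3 by (auto simp: m_def)
      have "(D_mat r \<rho> b *\<^sub>v xi_vec S \<rho> (x t) (u t)) $ m = 0" unfolding D using m' by simp
      moreover have "(E_mat r \<rho> b *\<^sub>v \<phi> t) $ m = (\<Sum>l=0..<r - \<rho>. if l = m + 1 then \<phi> t $ l else 0)"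
        unfolding E using m' by (intro sum.cong) auto
      moreover have "\<dots> = Z t $ (k + 1)" using m' 3 True t by (simp add: Z)
      moreover have "G_vec r \<rho> $ m = 0" using m m' by (simp add: G_vec_def)
      ultimately show ?thesis using d True by simp
    next
      case False
      then have kr: "k = r" and m': "m = r - \<rho> - 1" using k by (auto simp: m_def)
      \<comment> \<open>The closing row is divided between the two matrices: \<open>D_mat\<close>
        holds the columns \<open>1..\<rho>\<close>, and \<open>E_mat\<close> those in
        \<open>\<rho> + 1..r\<close>, with its own index shifted by
        \<open>\<rho> + 1\<close>.\<close>
      have "(D_mat r \<rho> b *\<^sub>v xi_vec S \<rho> (x t) (u t)) $ m = (\<Sum>l=1..\<rho>. - b (l + 1) * Z t $ l)"
        unfolding D using t \<rho>
        by (intro sum.mono_neutral_cong_right) (auto simp: Z m')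
      moreover have "(E_mat r \<rho> b *\<^sub>v \<phi> t) $ m = (\<Sum>l=\<rho> + 1..r. - b (l + 1) * Z t $ l)"
        unfolding E using t \<rho> 3 kr
        by (intro sum.reindex_bij_witness[of _ "\<lambda>l. l - \<rho> - 1" "\<lambda>l. l + \<rho> + 1"]) (auto simp: Z m' ac_simps)
      moreover have "(\<Sum>l=1..\<rho>. - b (l + 1) * Z t $ l) + (\<Sum>l=\<rho> + 1..r. - b (l + 1) * Z t $ l)
          = (\<Sum>l=1..r. - b (l + 1) * Z t $ l)"
        using 3 kr by (subst sum.union_disjoint[symmetric]) (auto intro!: sum.cong)
      moreover have "G_vec r \<rho> $ m = 1" using m m' by (simp add: G_vec_def)
      ultimately show ?thesis using d kr by simp
    qed
  qed
qed

section \<open>Graph Laplacians\<close>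

text \<open>With eigenvectors as plain functions of the index, blocks and projections of a long
  vector become sums with shifted arguments, free of dimension side conditions.\<close>

lemma eigenvalue_iff_function:
  fixes M :: "'a::field mat"
  assumes M: "M \<in> carrier_mat n n"
  shows "eigenvalue M \<epsilon> \<longleftrightarrow>
    (\<exists>v. (\<exists>i<n. v i \<noteq> 0) \<and> (\<forall>i<n. (\<Sum>j<n. M $$ (i, j) * v j) = \<epsilon> * v i))"
proof
  assume "eigenvalue M \<epsilon>"
  then obtain v where v: "v \<in> carrier_vec n" "v \<noteq> 0\<^sub>v n" "M *\<^sub>v v = \<epsilon> \<cdot>\<^sub>v v"
    using M by (auto simp: eigenvalue_def eigenvector_def)
  have "\<exists>i<n. v $ i \<noteq> 0" using v(1,2) by (metis carrier_vecD eq_vecI index_zero_vec)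
  moreover have "(\<Sum>j<n. M $$ (i, j) * v $ j) = \<epsilon> * v $ i" if "i < n" for i
    using arg_cong[OF v(3), of "\<lambda>w. w $ i"] that M v(1) by (simp add: scalar_prod_def lessThan_atLeast0)
  ultimately show "\<exists>v. (\<exists>i<n. v i \<noteq> 0) \<and> (\<forall>i<n. (\<Sum>j<n. M $$ (i, j) * v j) = \<epsilon> * v i)" by blast
next
  assume "\<exists>v. (\<exists>i<n. v i \<noteq> 0) \<and> (\<forall>i<n. (\<Sum>j<n. M $$ (i, j) * v j) = \<epsilon> * v i)"
  then obtain v where v: "\<exists>i<n. v i \<noteq> 0" "\<And>i. i < n \<Longrightarrow> (\<Sum>j<n. M $$ (i, j) * v j) = \<epsilon> * v i" by blast
  have "vec n v \<noteq> 0\<^sub>v n" using v(1) by (metis index_vec index_zero_vec(1))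
  moreover have "M *\<^sub>v vec n v = \<epsilon> \<cdot>\<^sub>v vec n v"
    using M v(2) by (intro eq_vecI) (auto simp: scalar_prod_def lessThan_atLeast0)
  ultimately show "eigenvalue M \<epsilon>"
    using M by (auto simp: eigenvalue_def eigenvector_def intro!: exI[of _ "vec n v"])
qed

lemma cspectrum_iff:
  assumes "M \<in> carrier_mat n n"
  shows "\<epsilon> \<in> cspectrum M \<longleftrightarrow>
    (\<exists>v. (\<exists>i<n. v i \<noteq> 0) \<and> (\<forall>i<n. (\<Sum>j<n. complex_of_real (M $$ (i, j)) * v j) = \<epsilon> * v i))"
  using assms unfolding cspectrum_def spectrum_def
  by (subst mem_Collect_eq, subst eigenvalue_iff_function[of _ n]) auto

lemma finite_cspectrum:
  assumes "M \<in> carrier_mat n n"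
  shows "finite (cspectrum M)"
  unfolding cspectrum_def using assms by (intro card_finite_spectrum(1)[of _ n]) auto

text \<open>Resolves the choice in \<open>lambda_min\<close>: the finite spectrum attains its least
  nonzero real part, and all eigenvalues that qualify share it.\<close>

lemma Re_lambda_min:
  assumes M: "M \<in> carrier_mat n n" and ex: "\<exists>\<epsilon>\<in>cspectrum M. Re \<epsilon> \<noteq> 0"
  shows "Re (lambda_min M) = Min {Re \<epsilon> | \<epsilon>. \<epsilon> \<in> cspectrum M \<and> Re \<epsilon> \<noteq> 0}"
proof -
  let ?X = "{Re \<epsilon> | \<epsilon>. \<epsilon> \<in> cspectrum M \<and> Re \<epsilon> \<noteq> 0}"
  have fin: "finite ?X" using finite_cspectrum[OF M] by simp
  have "?X \<noteq> {}" using ex by auto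
  from Min_in[OF fin this] obtain \<epsilon> where \<epsilon>: "\<epsilon> \<in> cspectrum M" "Re \<epsilon> \<noteq> 0" "Re \<epsilon> = Min ?X" by auto
  let ?P = "\<lambda>\<epsilon>. \<epsilon> \<in> cspectrum M \<and> Re \<epsilon> \<noteq> 0 \<and> (\<forall>\<kappa>\<in>cspectrum M. Re \<kappa> \<noteq> 0 \<longrightarrow> Re \<epsilon> \<le> Re \<kappa>)"
  have "?P \<epsilon>" using \<epsilon> fin by (auto intro!: Min_le)
  then have "?P (lambda_min M)" unfolding lambda_min_def by (rule someI)
  then show ?thesis using fin by (intro Min_eqI[symmetric]) auto
qed

text \<open>The trace is invariant under similarity, so it can be read off a triangular form whose
  diagonal consists of eigenvalues.\<close>

lemma nilpotent_trace:
  fixes M :: "complex mat"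
  assumes M: "M \<in> carrier_mat n n" and ev: "\<And>\<epsilon>. eigenvalue M \<epsilon> \<Longrightarrow> \<epsilon> = 0"
  shows "(\<Sum>i<n. M $$ (i, i)) = 0"
proof -
  obtain T P Q where carr: "T \<in> carrier_mat n n" "P \<in> carrier_mat n n" "Q \<in> carrier_mat n n"
    and PQ: "P * Q = 1\<^sub>m n" and QP: "Q * P = 1\<^sub>m n" and MT: "M = P * T * Q"
    and T_ev: "\<And>k. k < n \<Longrightarrow> eigenvalue M (T $$ (k, k))"
    using complex_schur_form[OF M] by metis
  have trace_comm: "(\<Sum>i<n. (A * B) $$ (i, i)) = (\<Sum>i<n. (B * A) $$ (i, i))"
    if "A \<in> carrier_mat n n" "B \<in> carrier_mat n n" for A B :: "complex mat"
  proof -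
    have "(\<Sum>i<n. (A * B) $$ (i, i)) = (\<Sum>i<n. \<Sum>k<n. A $$ (i, k) * B $$ (k, i))"
      using that by (intro sum.cong) (auto simp: scalar_prod_def lessThan_atLeast0)
    also have "\<dots> = (\<Sum>k<n. \<Sum>i<n. A $$ (i, k) * B $$ (k, i))" by (rule sum.swap)
    also have "\<dots> = (\<Sum>k<n. (B * A) $$ (k, k))"
      using that by (intro sum.cong) (auto simp: scalar_prod_def lessThan_atLeast0 mult.commute)
    finally show ?thesis .
  qed
  have "Q * (P * T) = (Q * P) * T" using carr by (intro assoc_mult_mat[symmetric]) auto
  then have "Q * (P * T) = T" using carr by (simp add: QP)
  then have "(\<Sum>i<n. M $$ (i, i)) = (\<Sum>i<n. T $$ (i, i))"
    unfolding MT using carr trace_comm[of "P * T" Q] by simp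
  also have "\<dots> = 0" using T_ev ev by (intro sum.neutral) auto
  finally show ?thesis .
qed

section \<open>Laplacian spectra and spanning trees\<close>

lemma weighted_digraph_nonneg:
  assumes "weighted_digraph N E a" "i < N" "j < N"
  shows "0 \<le> a i j"
  using assms unfolding weighted_digraph_def by (metis less_eq_real_def)

lemma laplacian_carrier: "laplacian N a \<in> carrier_mat N N"
  by (simp add: laplacian_def)

lemma laplacian_apply:
  fixes x :: "nat \<Rightarrow> 'a::real_algebra_1"
  assumes "i < N"
  shows "(\<Sum>j<N. of_real (laplacian N a $$ (i, j)) * x j) = (\<Sum>j<N. of_real (a i j) * (x i - x j))"
proof -
  have "(\<Sum>j<N. of_real (laplacian N a $$ (i, j)) * x j) =
      (\<Sum>j<N. (if j = i then of_real (\<Sum>k<N. a i k) * x i else 0) - of_real (a i j) * x j)"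
    using assms by (intro sum.cong) (auto simp: laplacian_def left_diff_distrib)
  also have "\<dots> = (\<Sum>j<N. of_real (a i j) * (x i - x j))"
    using assms by (simp add: sum_subtractf right_diff_distrib sum_distrib_right)
  finally show ?thesis .
qed

text \<open>Gershgorin: the eigenvalue lies in a disc that touches the imaginary axis only at the origin.\<close>

lemma laplacian_eigenvalue:
  fixes x :: "nat \<Rightarrow> complex"
  assumes a: "\<And>i j. i < N \<Longrightarrow> j < N \<Longrightarrow> 0 \<le> a i j"
    and x: "\<And>i. i < N \<Longrightarrow> (\<Sum>j<N. of_real (a i j) * (x i - x j)) = \<epsilon> * x i"
    and nz: "\<exists>i<N. x i \<noteq> 0"
  shows "\<epsilon> = 0 \<or> 0 < Re \<epsilon>"
proof -
  let ?X = "(\<lambda>i. cmod (x i)) ` {..<N}"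
  have "Max ?X \<in> ?X" using nz by (intro Max_in) auto
  then obtain i where i: "i < N" "Max ?X = cmod (x i)" by auto
  have le: "cmod (x j) \<le> cmod (x i)" if "j < N" for j
    unfolding i(2)[symmetric] using that by (intro Max_ge) auto
  then have pos: "cmod (x i) > 0" using nz by (metis norm_le_zero_iff not_le order_trans zero_less_norm_iff)
  \<comment> \<open>The weight of a self-loop is included; it then counts in the centre and in the
    radius of the disc alike.\<close>
  define d where "d = (\<Sum>j<N. a i j)"
  have d0: "d \<ge> 0" unfolding d_def using a i by (intro sum_nonneg) auto
  have "(of_real d - \<epsilon>) * x i = (\<Sum>j<N. of_real (a i j) * x j)"
    using x[OF i(1)] by (simp add: d_def algebra_simps sum_subtractf sum_distrib_left)
  then have "cmod (of_real d - \<epsilon>) * cmod (x i) = cmod (\<Sum>j<N. of_real (a i j) * x j)"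
    by (metis norm_mult)
  also have "\<dots> \<le> (\<Sum>j<N. a i j * cmod (x i))"
    using a i le by (intro sum_norm_le) (auto simp: norm_mult intro!: mult_left_mono)
  also have "\<dots> = d * cmod (x i)" by (simp add: d_def sum_distrib_right)
  finally have disc: "cmod (of_real d - \<epsilon>) \<le> d" using pos by simp
  then have "(d - Re \<epsilon>)\<^sup>2 + (Im \<epsilon>)\<^sup>2 \<le> d\<^sup>2"
    using power_mono[OF disc norm_ge_zero, of 2] by (simp add: cmod_power2)
  show ?thesis
  proof (cases "0 < Re \<epsilon>")
    case False
    \<comment> \<open>With a non-positive real part the horizontal distance to the centre is already
      at least \<open>d\<close>, so nothing is left for the imaginary part.\<close>
    then have "d\<^sup>2 \<le> (d - Re \<epsilon>)\<^sup>2" using d0 by (intro power_mono) auto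
    with \<open>(d - Re \<epsilon>)\<^sup>2 + (Im \<epsilon>)\<^sup>2 \<le> d\<^sup>2\<close> have "(Im \<epsilon>)\<^sup>2 \<le> 0" "(d - Re \<epsilon>)\<^sup>2 \<le> d\<^sup>2"
      using zero_le_power2[of "Im \<epsilon>"] by linarith+
    then have "Im \<epsilon> = 0" "d - Re \<epsilon> \<le> d" using d0 by (auto simp: power2_le_iff_abs_le)
    then have "Im \<epsilon> = 0" "Re \<epsilon> = 0" using False by auto
    then show ?thesis by (simp add: complex_eq_iff)
  qed simp
qed

text \<open>Maximum principle. At a maximum all summands are nonnegative, so \<open>c\<close> is
  nonnegative, and the same for \<open>- x\<close> gives \<open>c = 0\<close>. Then every agent that
  a maximal agent listens to is maximal too, and walking a path back to the root shows that the
  maximum is attained there. By symmetry so is the minimum. Allowing a constant \<open>c\<close>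
  also excludes generalized eigenvectors over the constant ones.\<close>

lemma laplacian_const_imp_const:
  fixes x :: "nat \<Rightarrow> real"
  assumes G: "weighted_digraph N E a" and rt: "rt < N" "\<forall>j<N. (rt, j) \<in> (E\<inverse>)\<^sup>*"
    and x: "\<And>i. i < N \<Longrightarrow> (\<Sum>j<N. a i j * (x i - x j)) = c"
    and i: "i < N"
  shows "x i = x rt"
proof -
  note a = weighted_digraph_nonneg[OF G]
  have key: "0 \<le> c \<and> (c \<le> 0 \<longrightarrow> (\<forall>i<N. x i \<le> x rt))"
    if x: "\<And>i. i < N \<Longrightarrow> (\<Sum>j<N. a i j * (x i - x j)) = c" for x :: "nat \<Rightarrow> real" and c
  proof -
    let ?X = "x ` {..<N}"
    have "Max ?X \<in> ?X" using rt by (intro Max_in) auto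
    then obtain m where m: "m < N" "Max ?X = x m" by auto
    have le: "x j \<le> x m" if "j < N" for j
      unfolding m(2)[symmetric] using that by (intro Max_ge) auto
    have nonneg: "0 \<le> a i j * (x i - x j)" if "x i = x m" "i < N" "j < N" for i j
      using that a le[of j] by (intro mult_nonneg_nonneg) auto
    have "0 \<le> c" unfolding x[OF m(1), symmetric] using nonneg m by (intro sum_nonneg) auto
    moreover have "x rt = x m" if c: "c \<le> 0"
      using rt(2)[rule_format, OF m(1)]
    proof (induction rule: converse_rtrancl_induct)
      case (step y z)
      then have E: "(z, y) \<in> E" by simp
      then have N: "z < N" "y < N" using G by (auto simp: weighted_digraph_def)
      have "(\<Sum>j<N. a z j * (x z - x j)) = 0"
        using x[OF N(1)] c \<open>0 \<le> c\<close> by simp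
      then have "a z y * (x z - x y) = 0"
        using nonneg[OF step.IH N(1)] N(2) by (subst (asm) sum_nonneg_eq_0_iff) auto
      moreover have "a z y > 0" using G E N unfolding weighted_digraph_def by metis
      ultimately show ?case using step.IH by simp
    qed simp
    ultimately show ?thesis using le by metis
  qed
  have "(\<Sum>j<N. a i j * (- x i - - x j)) = - c" if "i < N" for i
  proof -
    have "(\<Sum>j<N. a i j * (- x i - - x j)) = - (\<Sum>j<N. a i j * (x i - x j))"
      by (simp add: sum_negf[symmetric] algebra_simps)
    then show ?thesis using x[OF that] by simp
  qed
  from key[of "\<lambda>i. - x i", OF this] key[of x c, OF x] i show ?thesis by force
qed

text \<open>Otherwise 0 is the only eigenvalue and the trace vanishes. The trace is the sum of all
  weights between distinct agents, so no such weight would be left, and the indicator of the root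
  would be a non-constant vector in the kernel.\<close>

lemma spanning_tree_nonzero_eigenvalue:
  assumes G: "weighted_digraph N E a" and tree: "has_spanning_tree N E" and N: "2 \<le> N"
  shows "\<exists>\<epsilon>\<in>cspectrum (laplacian N a). Re \<epsilon> \<noteq> 0"
proof (rule ccontr)
  assume neg: "\<not> ?thesis"
  obtain rt where rt: "rt < N" "\<forall>j<N. (rt, j) \<in> (E\<inverse>)\<^sup>*"
    using tree by (auto simp: has_spanning_tree_def)
  note a = weighted_digraph_nonneg[OF G]
  let ?L = "map_mat complex_of_real (laplacian N a)"
  have L: "?L \<in> carrier_mat N N" using laplacian_carrier by simp
  have "\<epsilon> = 0" if "eigenvalue ?L \<epsilon>" for \<epsilon>
  proof -
    have "\<epsilon> \<in> cspectrum (laplacian N a)" using that by (simp add: cspectrum_def spectrum_def)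
    moreover obtain v where "\<exists>i<N. v i \<noteq> 0" "\<forall>i<N. (\<Sum>j<N. of_real (laplacian N a $$ (i, j)) * v j) = \<epsilon> * v i"
      using calculation unfolding cspectrum_iff[OF laplacian_carrier] by blast
    ultimately show ?thesis
      using neg laplacian_eigenvalue[of N a v \<epsilon>, OF a] by (simp add: laplacian_apply)
  qed
  from nilpotent_trace[OF L this] have "(\<Sum>i<N. ?L $$ (i, i)) = 0" .
  also have "(\<Sum>i<N. ?L $$ (i, i)) = complex_of_real (\<Sum>i<N. laplacian N a $$ (i, i))"
    using laplacian_carrier[of N a] by simp
  finally have tr: "(\<Sum>i<N. laplacian N a $$ (i, i)) = 0" by (simp only: of_real_eq_0_iff)
  have diag: "laplacian N a $$ (i, i) = (\<Sum>k\<in>{..<N} - {i}. a i k)" if "i < N" for i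
    using that by (simp add: laplacian_def sum_diff1)
  have off: "a i k = 0" if "i < N" "k < N" "i \<noteq> k" for i k
  proof -
    have nn: "0 \<le> a j l" if "j < N" "l \<in> {..<N} - {j}" for j l
      using a that by simp
    have "0 \<le> laplacian N a $$ (j, j)" if "j \<in> {..<N}" for j
      unfolding diag[OF that[unfolded lessThan_iff]] using that nn by (intro sum_nonneg) auto
    then have "laplacian N a $$ (i, i) = 0"
      using tr sum_nonneg_eq_0_iff[of "{..<N}" "\<lambda>j. laplacian N a $$ (j, j)"] that(1) by blast
    then have "(\<Sum>k\<in>{..<N} - {i}. a i k) = 0" using diag[OF that(1)] by simp
    then show ?thesis
      using sum_nonneg_eq_0_iff[of "{..<N} - {i}" "a i"] nn[OF that(1)] that by auto
  qed
  define x :: "nat \<Rightarrow> real" where "x = (\<lambda>i. if i = rt then 1 else 0)"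
  have x0: "(\<Sum>j<N. a i j * (x i - x j)) = 0" if "i < N" for i
  proof (intro sum.neutral ballI)
    show "a i j * (x i - x j) = 0" if "j \<in> {..<N}" for j
      using off[of i j] \<open>i < N\<close> that by (cases "i = j") simp_all
  qed
  have const: "x i = x rt" if "i < N" for i
    using laplacian_const_imp_const[OF G rt, where x = x and c = 0, OF x0] that by blast
  \<comment> \<open>The index is a vertex other than the root; it exists because
    \<open>2 \<le> N\<close>.\<close>
  show False
    using const[of "if rt = 0 then 1 else 0"] N by (cases "rt = 0") (simp_all add: x_def)
qed

text \<open>The disagreement dynamics relative to the root. Subtracting the root row from every row
  removes the eigenvalue 0 of the Laplacian, and the added diagonal entry acts only on the
  disagreement of the root with itself, which vanishes.\<close>

definition disagreement_mat :: "nat \<Rightarrow> (nat \<Rightarrow> nat \<Rightarrow> real) \<Rightarrow> nat \<Rightarrow> real mat" where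
  "disagreement_mat N a rt = mat N N (\<lambda>(i, j).
     laplacian N a $$ (i, j) - laplacian N a $$ (rt, j) + (if i = rt \<and> j = rt then 1 else 0))"

lemma disagreement_mat_apply:
  fixes x :: "nat \<Rightarrow> 'a::real_algebra_1"
  assumes "i < N" "rt < N"
  shows "(\<Sum>j<N. of_real (disagreement_mat N a rt $$ (i, j)) * x j) =
    (\<Sum>j<N. of_real (a i j) * (x i - x j)) - (\<Sum>j<N. of_real (a rt j) * (x rt - x j))
      + (if i = rt then x rt else 0)"
proof -
  have "(\<Sum>j<N. of_real (disagreement_mat N a rt $$ (i, j)) * x j) =
      (\<Sum>j<N. of_real (laplacian N a $$ (i, j)) * x j - of_real (laplacian N a $$ (rt, j)) * x j
        + (if j = rt then (if i = rt then x rt else 0) else 0))"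
    using assms by (intro sum.cong) (auto simp: disagreement_mat_def algebra_simps)
  also have "\<dots> = (\<Sum>j<N. of_real (a i j) * (x i - x j)) - (\<Sum>j<N. of_real (a rt j) * (x rt - x j))
      + (if i = rt then x rt else 0)"
    using assms by (simp only: sum.distrib sum_subtractf laplacian_apply) simp
  finally show ?thesis .
qed

text \<open>If \<open>v\<close> does not vanish at the root, the root row forces
  \<open>\<epsilon> = 1\<close>, the added diagonal entry. Otherwise the equation reads
  \<open>L v = \<epsilon> v + c\<close> with one constant \<open>c\<close> for all rows. For
  \<epsilon> = 0 the maximum principle makes \<open>v\<close> constant, hence zero; for other
  \<epsilon> the shift of \<open>v\<close> by \<open>c / \<epsilon>\<close> is an eigenvector of the
  Laplacian.\<close>

lemma disagreement_mat_eigenvalue: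
  assumes G: "weighted_digraph N E a" and rt: "rt < N" "\<forall>j<N. (rt, j) \<in> (E\<inverse>)\<^sup>*"
    and ev: "\<epsilon> \<in> cspectrum (disagreement_mat N a rt)"
  shows "0 < Re \<epsilon>"
proof -
  note a = weighted_digraph_nonneg[OF G]
  obtain v where nz: "\<exists>i<N. v i \<noteq> 0"
    and dv: "\<And>i. i < N \<Longrightarrow> (\<Sum>j<N. complex_of_real (disagreement_mat N a rt $$ (i, j)) * v j) = \<epsilon> * v i"
    using ev by (subst (asm) cspectrum_iff[of _ N]) (auto simp: disagreement_mat_def)
  define c where "c = (\<Sum>j<N. of_real (a rt j) * (v rt - v j))"
  have v: "(\<Sum>j<N. of_real (a i j) * (v i - v j)) = \<epsilon> * v i + c - (if i = rt then v rt else 0)"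
    if "i < N" for i
  proof -
    have "A - c + d = e \<Longrightarrow> A = e + c - d" for A d e :: complex by (simp add: algebra_simps)
    then show ?thesis
      using dv[OF that] unfolding disagreement_mat_apply[OF that rt(1)] c_def[symmetric] by blast
  qed
  show ?thesis
  proof (cases "v rt = 0")
    case False
    then have "\<epsilon> = 1" using v[OF rt(1)] by (simp add: c_def)
    then show ?thesis by simp
  next
    case rt0: True
    then have v: "(\<Sum>j<N. of_real (a i j) * (v i - v j)) = \<epsilon> * v i + c" if "i < N" for i
      using v[OF that] by simp
    show ?thesis
    proof (cases "\<epsilon> = 0")
      case True
      then have ReIm: "(\<Sum>j<N. a i j * (Re (v i) - Re (v j))) = Re c" "(\<Sum>j<N. a i j * (Im (v i) - Im (v j))) = Im c"
        if "i < N" for i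
        using arg_cong[OF v[OF that], of Re] arg_cong[OF v[OF that], of Im] by simp_all
      from laplacian_const_imp_const[OF G rt, where x = "\<lambda>i. Re (v i)", OF ReIm(1)]
        laplacian_const_imp_const[OF G rt, where x = "\<lambda>i. Im (v i)", OF ReIm(2)]
      have "Re (v i) = Re (v rt)" "Im (v i) = Im (v rt)" if "i < N" for i
        using that by metis+
      then have "v i = 0" if "i < N" for i using that rt0 by (simp add: complex_eq_iff)
      then show ?thesis using nz by auto
    next
      case False
      define u where "u = (\<lambda>i. v i + c / \<epsilon>)"
      have "(\<Sum>j<N. of_real (a i j) * (u i - u j)) = \<epsilon> * u i" if "i < N" for i
        proof -
        have "\<epsilon> * u i = \<epsilon> * v i + c" using False by (simp add: u_def distrib_left)
        then show ?thesis using v[OF that] by (simp add: u_def)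
      qed
      moreover have "\<exists>i<N. u i \<noteq> 0"
      proof (rule ccontr)
        assume "\<not> ?thesis"
        then have u0: "u i = 0" if "i < N" for i using that by auto
        then have "c / \<epsilon> = 0" using u0[OF rt(1)] rt0 by (simp add: u_def)
        then show False using nz u0 by (auto simp: u_def)
      qed
      ultimately show ?thesis using laplacian_eigenvalue[of N a u \<epsilon>, OF a] False by blast
    qed
  qed
qed

text \<open>Constant vectors are equilibria of the flow, so decay is shown for the differences to
  the root; two of these give the difference of any two agents.\<close>

lemma laplacian_flow_consensus:
  fixes w :: "nat \<Rightarrow> real \<Rightarrow> real"
  assumes G: "weighted_digraph N E a" and tree: "has_spanning_tree N E" and \<kappa>: "\<kappa> > 0"
    and w: "\<And>i t. i < N \<Longrightarrow> t \<ge> 0 \<Longrightarrow>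
      (w i has_real_derivative - \<kappa> * (\<Sum>j<N. a i j * (w i t - w j t))) (at t within {0..})"
    and ij: "i < N" "j < N"
  shows "((\<lambda>t. w i t - w j t) \<longlongrightarrow> 0) at_top"
proof -
  obtain rt where rt: "rt < N" "\<forall>j<N. (rt, j) \<in> (E\<inverse>)\<^sup>*"
    using tree by (auto simp: has_spanning_tree_def)
  define x where "x = (\<lambda>i t. complex_of_real (w i t - w rt t))"
  define D where "D = disagreement_mat N a rt"
  define M where "M = map_mat complex_of_real (- \<kappa> \<cdot>\<^sub>m D)"
  have D: "D \<in> carrier_mat N N" by (simp add: D_def disagreement_mat_def)
  have M: "M \<in> carrier_mat N N" using D by (simp add: M_def)
  have decay: "(x i \<longlongrightarrow> 0) at_top" if "i < N" for i
  proof (rule hurwitz_ode_decay[OF M _ _ that])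
    fix \<epsilon> assume "eigenvalue M \<epsilon>"
    then obtain v where v: "\<exists>i<N. v i \<noteq> 0" "\<forall>i<N. (\<Sum>j<N. M $$ (i, j) * v j) = \<epsilon> * v i"
      unfolding eigenvalue_iff_function[OF M] by blast
    have "(\<Sum>j<N. complex_of_real (D $$ (i, j)) * v j) = (- \<epsilon> / \<kappa>) * v i" if "i < N" for i
    proof -
      have "\<epsilon> * v i = - \<kappa> * (\<Sum>j<N. complex_of_real (D $$ (i, j)) * v j)"
        unfolding v(2)[rule_format, OF that, symmetric] sum_distrib_left using that D
        by (intro sum.cong) (auto simp: M_def)
      then have "- \<epsilon> / \<kappa> * v i = \<kappa> * (\<Sum>j<N. complex_of_real (D $$ (i, j)) * v j) / \<kappa>"
        by simp
      then show ?thesis using \<kappa> by simp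
    qed
    then have "- \<epsilon> / \<kappa> \<in> cspectrum D" unfolding cspectrum_iff[OF D] using v(1) by blast
    then have "0 < Re (- \<epsilon> / \<kappa>)" unfolding D_def by (rule disagreement_mat_eigenvalue[OF G rt])
    then show "Re \<epsilon> < 0" using \<kappa> by (simp add: divide_less_0_iff)
  next
    fix k t assume k: "k < N" and t: "(t::real) \<ge> 0"
    let ?d = "\<lambda>i. - \<kappa> * (\<Sum>j<N. a i j * (w i t - w j t))"
    have "(x k has_vector_derivative of_real (?d k - ?d rt)) (at t within {0..})"
      unfolding x_def
      using DERIV_diff[OF w[OF k t] w[OF rt(1) t]]
      by (intro has_vector_derivative_of_real) (simp add: has_real_derivative_iff_has_vector_derivative)
    moreover have "(\<Sum>l<N. M $$ (k, l) * x l t) = of_real (?d k - ?d rt)"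
    proof -
      have "(\<Sum>l<N. M $$ (k, l) * x l t) = - \<kappa> * (\<Sum>l<N. of_real (D $$ (k, l)) * x l t)"
        unfolding sum_distrib_left using k D by (intro sum.cong) (auto simp: M_def)
      also have "\<dots> = of_real (?d k - ?d rt)"
        unfolding D_def disagreement_mat_apply[OF k rt(1)] by (simp add: x_def algebra_simps)
      finally show ?thesis .
    qed
    ultimately show "(x k has_vector_derivative (\<Sum>l<N. M $$ (k, l) * x l t)) (at t within {0..})" by simp
  qed
  have "((\<lambda>t. complex_of_real (w i t - w j t)) \<longlongrightarrow> 0) at_top"
    using tendsto_diff[OF decay[OF ij(1)] decay[OF ij(2)]] by (simp add: x_def)
  from tendsto_Re[OF this] show ?thesis by simp
qed

section \<open>The closed-loop spectrum\<close>

lemma A_mat_carrier: "A_mat r b \<in> carrier_mat (r + 1) (r + 1)"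
  by (simp add: A_mat_def)

text \<open>Stated over \<open>real_algebra_1\<close> so that it serves real trajectories as well as
  complex eigenvectors.\<close>

lemma A_mat_apply:
  fixes x :: "nat \<Rightarrow> 'a::real_algebra_1"
  assumes "k < r + 1"
  shows "(\<Sum>l<r + 1. of_real (A_mat r b $$ (k, l)) * x l) =
    (if k < r then x (k + 1) else (\<Sum>l=1..r. - of_real (b (l + 1)) * x l))"
proof (cases "k < r")
  case True
  then have "(\<Sum>l<r + 1. of_real (A_mat r b $$ (k, l)) * x l) = (\<Sum>l<r + 1. if l = k + 1 then x l else 0)"
    by (intro sum.cong) (auto simp: A_mat_def)
  also have "\<dots> = x (k + 1)" using True by simp
  finally show ?thesis using True by simp
next
  case False
  then have "k = r" using assms by simp
  have "(\<Sum>l<r + 1. of_real (A_mat r b $$ (k, l)) * x l) = (\<Sum>l=1..r. - of_real (b (l + 1)) * x l)"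
    unfolding \<open>k = r\<close> by (rule sum.mono_neutral_cong_right) (auto simp: A_mat_def)
  then show ?thesis using False by simp
qed

text \<open>In column \<open>k + 1\<close> only the superdiagonal entry and the last row can
  contribute. Up to the factor \<open>\<nu> $ r\<close>, the vector \<nu> therefore lists the
  coefficients of \<open>P\<close>, which is what ties it to the outputs.\<close>

lemma A_mat_left_null_vector:
  assumes "eigenvector (transpose_mat (A_mat r b)) \<nu> 0"
  shows "\<nu> \<in> carrier_vec (r + 1)"
    and "\<And>l. l < r + 1 \<Longrightarrow> (\<Sum>k<r + 1. \<nu> $ k * A_mat r b $$ (k, l)) = 0"
    and "\<And>k. k < r \<Longrightarrow> \<nu> $ k = b (k + 2) * \<nu> $ r"
proof -
  show c: "\<nu> \<in> carrier_vec (r + 1)"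
    using assms by (simp add: eigenvector_def A_mat_def)
  have eq: "transpose_mat (A_mat r b) *\<^sub>v \<nu> = 0 \<cdot>\<^sub>v \<nu>" using assms by (simp add: eigenvector_def)
  show null: "(\<Sum>k<r + 1. \<nu> $ k * A_mat r b $$ (k, l)) = 0" if "l < r + 1" for l
    using arg_cong[OF eq, of "\<lambda>w. w $ l"] that c A_mat_carrier[of r b]
    by (simp add: scalar_prod_def lessThan_atLeast0 mult.commute)
  show "\<nu> $ k = b (k + 2) * \<nu> $ r" if "k < r" for k
  proof -
    have "(\<Sum>j<r + 1. \<nu> $ j * A_mat r b $$ (j, k + 1)) =
        (\<Sum>j<r + 1. (if j = k then \<nu> $ k else 0) + (if j = r then - b (k + 2) * \<nu> $ r else 0))"
      using that by (intro sum.cong) (auto simp: A_mat_def)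
    also have "\<dots> = \<nu> $ k - b (k + 2) * \<nu> $ r"
      using that by (subst sum.distrib) simp
    finally show ?thesis using null[of "k + 1"] that by simp
  qed
qed

lemma B_vec_scalar_prod:
  assumes "\<nu> \<in> carrier_vec (r + 1)"
  shows "B_vec r \<bullet> \<nu> = \<nu> $ r"
  using assms by (simp add: B_vec_def)

text \<open>If \<open>b 2\<close> vanished, the first two columns would each split off a factor \<open>X\<close>.\<close>

lemma A_mat_simple_zero:
  assumes r: "0 < r" and ord: "Polynomial.order 0 (char_poly (A_mat r b)) = 1"
  shows "b 2 \<noteq> 0"
proof
  assume b: "b 2 = 0"
  define C where "C = mat_delete (A_mat r b) 0 0"
  have C: "C \<in> carrier_mat r r" by (simp add: C_def mat_delete_def A_mat_def)
  have "char_poly (A_mat r b) = monom 1 1 * char_poly C"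
    unfolding C_def by (rule char_poly_0_column[OF _ A_mat_carrier]) (auto simp: A_mat_def)
  also have "char_poly C = monom 1 1 * char_poly (mat_delete C 0 0)"
    using r b[unfolded numeral_2_eq_2] by (intro char_poly_0_column[OF _ C]) (auto simp: C_def mat_delete_def A_mat_def)
  finally have "char_poly (A_mat r b) = [:- 0, 1:] ^ 2 * char_poly (mat_delete C 0 0)"
    by (simp add: power2_eq_square monom_Suc mult.assoc one_pCons)
  then have "[:- 0, 1:] ^ 2 dvd char_poly (A_mat r b)" by (rule dvdI)
  moreover have "char_poly (A_mat r b) \<noteq> 0"
    using degree_monic_char_poly[OF A_mat_carrier, of r b] by auto
  ultimately have "2 \<le> Polynomial.order 0 (char_poly (A_mat r b))"
    by (simp only: order_divides) simp
  then show False using ord by simp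
qed

text \<open>A root of \<open>P\<close> is a root of \<open>s P(s)\<close>, hence real and
  non-positive, and \<open>b 2 \<noteq> 0\<close> excludes 0. The last conclusion restates the root
  equation in the shape of the last row of \<open>A_mat\<close>.\<close>

lemma companion_factorization:
  fixes b :: "nat \<Rightarrow> real"
  assumes r: "0 < r" and b: "b 2 \<noteq> 0"
    and roots: "\<And>s :: complex.
      s ^ (r + 1) + (\<Sum>k=2..r + 1. complex_of_real (b k) * s ^ (k - 1)) = 0 \<Longrightarrow> s \<in> \<real> \<and> Re s \<le> 0"
  obtains zs :: "complex list" where "length zs = r"
    and "\<And>k. k \<le> r \<Longrightarrow> coeff (\<Prod>z\<leftarrow>zs. [:- z, 1:]) k = (if k < r then of_real (b (k + 2)) else 1)"
    and "\<And>z. z \<in> set zs \<Longrightarrow> Re z < 0"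
    and "\<And>z. z \<in> set zs \<Longrightarrow> z ^ (r + 1) = (\<Sum>l=1..r. - of_real (b (l + 1)) * z ^ l)"
proof -
  \<comment> \<open>This is \<open>P\<close>. Dividing by \<open>s\<close> moves the coefficient
    \<open>b k\<close> from the power \<open>k - 1\<close> to \<open>k - 2\<close>, hence the index
    \<open>k + 2\<close>.\<close>
  define p :: "complex poly" where
    "p = Abs_poly (\<lambda>k. if k < r then of_real (b (k + 2)) else if k = r then 1 else 0)"
  have cp: "coeff p k = (if k < r then of_real (b (k + 2)) else if k = r then 1 else 0)" for k
    unfolding p_def by (rule coeff_Abs_poly[of r, THEN fun_cong]) auto
  have deg: "degree p = r"
    using le_degree[of p r] degree_le[of r p] by (simp add: cp)
  obtain as where as: "Polynomial.smult (lead_coeff p) (\<Prod>z\<leftarrow>as. [:- z, 1:]) = p" "length as = degree p"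
    using fundamental_theorem_algebra_factorized[of p] by blast
  then have p: "p = (\<Prod>z\<leftarrow>as. [:- z, 1:])" by (simp add: deg cp)
  have root: "z ^ (r + 1) + (\<Sum>l=1..r. of_real (b (l + 1)) * z ^ l) = 0" "z \<noteq> 0" if "z \<in> set as" for z
  proof -
    have "poly p z = 0" using that unfolding p by (simp add: poly_prod_list prod_list_zero_iff image_iff)
    then have "z * (\<Sum>k\<le>r. coeff p k * z ^ k) = 0" by (simp add: poly_altdef deg)
    also have "z * (\<Sum>k\<le>r. coeff p k * z ^ k) = (\<Sum>k<r. of_real (b (k + 2)) * z ^ (k + 1)) + z ^ (r + 1)"
      by (simp add: cp sum_distrib_left lessThan_Suc_atMost[symmetric] algebra_simps)
    also have "(\<Sum>k<r. complex_of_real (b (k + 2)) * z ^ (k + 1)) = (\<Sum>l=1..r. of_real (b (l + 1)) * z ^ l)"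
      by (rule sum.reindex_bij_witness[of _ "\<lambda>l. l - 1" "\<lambda>k. k + 1"]) auto
    finally show "z ^ (r + 1) + (\<Sum>l=1..r. of_real (b (l + 1)) * z ^ l) = 0" by (simp add: add.commute)
    show "z \<noteq> 0"
      using \<open>poly p z = 0\<close> b[unfolded numeral_2_eq_2] r cp[of 0] by (auto simp: poly_0_coeff_0)
  qed
  have "Re z < 0" if z: "z \<in> set as" for z
  proof -
    have "(\<Sum>k=2..r + 1. complex_of_real (b k) * z ^ (k - 1)) = (\<Sum>l=1..r. of_real (b (l + 1)) * z ^ l)"
      by (rule sum.reindex_bij_witness[of _ "\<lambda>l. l + 1" "\<lambda>k. k - 1"]) auto
    then have "z \<in> \<real> \<and> Re z \<le> 0" using roots[of z] root(1)[OF z] by simp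
    then show ?thesis using root(2)[OF z] by (auto simp: complex_is_Real_iff complex_eq_iff)
  qed
  moreover have "z ^ (r + 1) = (\<Sum>l=1..r. - of_real (b (l + 1)) * z ^ l)" if "z \<in> set as" for z
    using root(1)[OF that] by (simp add: sum_negf eq_neg_iff_add_eq_0)
  ultimately show thesis
    using that[of as] as(2) deg cp unfolding p[symmetric] by auto
qed

text \<open>The eigenvector consists of the powers \<open>1, z, ..., z^r\<close>: the superdiagonal
  shifts them, and the last row is the characteristic equation.\<close>

lemma vandermonde_eigenvalue:
  fixes z :: complex
  assumes "z ^ (r + 1) = (\<Sum>l=1..r. - of_real (b (l + 1)) * z ^ l)"
  shows "z \<in> cspectrum (A_mat r b)"
  unfolding cspectrum_iff[OF A_mat_carrier]
proof (intro exI[of _ "\<lambda>k. z ^ k"] conjI allI impI)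
  show "\<exists>i<r + 1. z ^ i \<noteq> 0" by (intro exI[of _ 0]) simp
  show "(\<Sum>j<r + 1. complex_of_real (A_mat r b $$ (i, j)) * z ^ j) = z * z ^ i" if "i < r + 1" for i
  proof (cases "i < r")
    case True
    then show ?thesis unfolding A_mat_apply[OF that] by simp
  next
    case False
    then have "i = r" using that by simp
    then show ?thesis unfolding A_mat_apply[OF that] using assms by simp
  qed
qed

section \<open>Kronecker products and the block structure of the closed loop\<close>

lemma block_index_less:
  assumes "i < N" "k < n"
  shows "i * n + k < N * (n :: nat)"
proof -
  have "i * n + k < Suc i * n" using assms(2) by simp
  also have "\<dots> \<le> N * n" using assms(1) by (intro mult_le_mono1) simp
  finally show ?thesis .
qed

lemma block_index_div: "k < n \<Longrightarrow> (i * n + k) div n = (i :: nat)"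
  and block_index_mod: "k < n \<Longrightarrow> (i * n + k) mod n = (k :: nat)"
  by (auto simp: mult.commute)

lemma kron_carrier:
  "X \<in> carrier_mat N N \<Longrightarrow> Y \<in> carrier_mat n n \<Longrightarrow> kron X Y \<in> carrier_mat (N * n) (N * n)"
  by (auto simp: kron_def)

lemma kron_apply:
  fixes z :: "nat \<Rightarrow> complex"
  assumes X: "X \<in> carrier_mat N N" and Y: "Y \<in> carrier_mat n n" and i: "i < N" and k: "k < n"
  shows "(\<Sum>q<N * n. of_real (kron X Y $$ (i * n + k, q)) * z q) =
    (\<Sum>j<N. of_real (X $$ (i, j)) * (\<Sum>l<n. of_real (Y $$ (k, l)) * z (j * n + l)))"
proof -
  have ik: "i * n + k < N * n"
    using i k by (rule block_index_less)
  have jl: "j * n + l < N * n" if "j < N" "l < n" for j l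
    using that by (rule block_index_less)
  have "(\<Sum>q<N * n. of_real (kron X Y $$ (i * n + k, q)) * z q)
      = (\<Sum>j<N. \<Sum>q=j * n..<j * n + n. of_real (kron X Y $$ (i * n + k, q)) * z q)"
    by (rule sum.nat_group[symmetric])
  also have "\<dots> = (\<Sum>j<N. \<Sum>l<n. of_real (kron X Y $$ (i * n + k, j * n + l)) * z (j * n + l))"
  proof (rule sum.cong[OF refl])
    fix j
    show "(\<Sum>q=j * n..<j * n + n. of_real (kron X Y $$ (i * n + k, q)) * z q) =
        (\<Sum>l<n. of_real (kron X Y $$ (i * n + k, j * n + l)) * z (j * n + l))"
      using sum.shift_bounds_nat_ivl[of "\<lambda>q. of_real (kron X Y $$ (i * n + k, q)) * z q" 0 "j * n" n]
      by (simp add: lessThan_atLeast0 add.commute)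
  qed
  also have "\<dots> = (\<Sum>j<N. \<Sum>l<n. of_real (X $$ (i, j)) * (of_real (Y $$ (k, l)) * z (j * n + l)))"
    using X Y ik jl k i by (intro sum.cong refl) (simp add: kron_def)
  finally show ?thesis by (simp add: sum_distrib_left)
qed

lemma closed_loop_mat_carrier:
  "\<nu> \<in> carrier_vec (r + 1) \<Longrightarrow> closed_loop_mat N a r b c \<nu> \<in> carrier_mat (N * (r + 1)) (N * (r + 1))"
  by (auto simp: closed_loop_mat_def kron_def outer_def laplacian_def A_mat_def B_vec_def)

text \<open>Because the coupling has rank 1, it sees a block vector only through the scalar
  projections of its blocks with \<nu>.\<close>

lemma closed_loop_mat_apply:
  fixes z :: "nat \<Rightarrow> complex"
  assumes \<nu>: "\<nu> \<in> carrier_vec (r + 1)" and i: "i < N" and k: "k < r + 1"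
  shows "(\<Sum>q<N * (r + 1). of_real (closed_loop_mat N a r b c \<nu> $$ (i * (r + 1) + k, q)) * z q) =
    (\<Sum>l<r + 1. of_real (A_mat r b $$ (k, l)) * z (i * (r + 1) + l)) -
    of_real (c * B_vec r $ k) *
      (\<Sum>j<N. of_real (laplacian N a $$ (i, j)) * (\<Sum>l<r + 1. of_real (\<nu> $ l) * z (j * (r + 1) + l)))"
proof -
  let ?n = "r + 1" let ?B = "outer (B_vec r) \<nu>"
  have B: "?B \<in> carrier_mat ?n ?n" using \<nu> by (auto simp: outer_def B_vec_def)
  have ik: "i * ?n + k < N * ?n"
    using i k by (rule block_index_less)
  have "(\<Sum>q<N * ?n. of_real (closed_loop_mat N a r b c \<nu> $$ (i * ?n + k, q)) * z q) =
      (\<Sum>q<N * ?n. of_real (kron (1\<^sub>m N) (A_mat r b) $$ (i * ?n + k, q)) * z q) -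
      of_real c * (\<Sum>q<N * ?n. of_real (kron (laplacian N a) ?B $$ (i * ?n + k, q)) * z q)"
    using ik kron_carrier[OF one_carrier_mat[of N] A_mat_carrier[of r b]] kron_carrier[OF laplacian_carrier[of N a] B]
    unfolding closed_loop_mat_def sum_distrib_left sum_subtractf[symmetric]
    by (intro sum.cong) (auto simp: left_diff_distrib mult.assoc)
  also have "(\<Sum>q<N * ?n. of_real (kron (1\<^sub>m N) (A_mat r b) $$ (i * ?n + k, q)) * z q) =
      (\<Sum>j<N. of_real ((1\<^sub>m N :: real mat) $$ (i, j)) * (\<Sum>l<?n. of_real (A_mat r b $$ (k, l)) * z (j * ?n + l)))"
    by (rule kron_apply[OF one_carrier_mat A_mat_carrier i k])
  also have "\<dots> = (\<Sum>j<N. if j = i then \<Sum>l<?n. of_real (A_mat r b $$ (k, l)) * z (j * ?n + l) else 0)"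
    using i by (intro sum.cong) auto
  also have "\<dots> = (\<Sum>l<?n. of_real (A_mat r b $$ (k, l)) * z (i * ?n + l))" using i by simp
  also have "(\<Sum>q<N * ?n. of_real (kron (laplacian N a) ?B $$ (i * ?n + k, q)) * z q) =
      (\<Sum>j<N. of_real (laplacian N a $$ (i, j)) * (\<Sum>l<?n. of_real (?B $$ (k, l)) * z (j * ?n + l)))"
    by (rule kron_apply[OF laplacian_carrier B i k])
  also have "\<dots> = of_real (B_vec r $ k) *
      (\<Sum>j<N. of_real (laplacian N a $$ (i, j)) * (\<Sum>l<?n. of_real (\<nu> $ l) * z (j * ?n + l)))"
    using \<nu> k by (simp add: outer_def B_vec_def sum_distrib_left mult.left_commute mult.assoc)
  finally show ?thesis by (simp add: mult.assoc)
qed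

text \<open>Projecting a block eigenvector with \<open>\<nu>\<close> annihilates \<open>A\<close> and yields either an eigenvector of the
  Laplacian or zero, and in the latter case the blocks are eigenvectors of \<open>A\<close>.\<close>

lemma closed_loop_spectrum:
  fixes c :: real
  assumes ev: "eigenvector (transpose_mat (A_mat r b)) \<nu> 0" and c: "c * (B_vec r \<bullet> \<nu>) \<noteq> 0"
    and N: "0 < N"
  defines "\<kappa> \<equiv> complex_of_real (c * (B_vec r \<bullet> \<nu>))"
  shows "{\<epsilon> \<in> cspectrum (closed_loop_mat N a r b c \<nu>). Re \<epsilon> \<noteq> 0} =
    (\<lambda>\<epsilon>. - \<kappa> * \<epsilon>) ` {\<epsilon> \<in> cspectrum (laplacian N a). Re \<epsilon> \<noteq> 0} \<union> {\<epsilon> \<in> cspectrum (A_mat r b). Re \<epsilon> \<noteq> 0}"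
    (is "?C = ?L \<union> ?A")
proof -
  let ?n = "r + 1"
  note \<nu> = A_mat_left_null_vector[OF ev]
  have \<nu>A: "(\<Sum>k<?n. of_real (\<nu> $ k) * (\<Sum>l<?n. of_real (A_mat r b $$ (k, l)) * x l)) = 0" for x :: "nat \<Rightarrow> complex"
  proof -
    have "(\<Sum>k<?n. of_real (\<nu> $ k) * (\<Sum>l<?n. of_real (A_mat r b $$ (k, l)) * x l)) =
        (\<Sum>l<?n. \<Sum>k<?n. of_real (\<nu> $ k) * (of_real (A_mat r b $$ (k, l)) * x l))"
      by (simp only: sum_distrib_left, rule sum.swap)
    also have "\<dots> = (\<Sum>l<?n. of_real (\<Sum>k<?n. \<nu> $ k * A_mat r b $$ (k, l)) * x l)"
      by (simp only: of_real_sum of_real_mult sum_distrib_right mult.assoc)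
    also have "\<dots> = 0" using \<nu>(2) by simp
    finally show ?thesis .
  qed
  have \<nu>B: "(\<Sum>k<?n. \<nu> $ k * B_vec r $ k) = B_vec r \<bullet> \<nu>"
    using \<nu>(1) by (simp add: scalar_prod_def lessThan_atLeast0 mult.commute)
  have C: "\<epsilon> \<in> cspectrum (closed_loop_mat N a r b c \<nu>) \<longleftrightarrow>
    (\<exists>z. (\<exists>p<N * ?n. z p \<noteq> 0) \<and> (\<forall>i<N. \<forall>k<?n.
      (\<Sum>q<N * ?n. of_real (closed_loop_mat N a r b c \<nu> $$ (i * ?n + k, q)) * z q) = \<epsilon> * z (i * ?n + k)))"
    (is "_ = (\<exists>z. _ \<and> ?Q z)") for \<epsilon>
  proof -
    have "(\<forall>p<N * ?n. P p) \<longleftrightarrow> (\<forall>i<N. \<forall>k<?n. P (i * ?n + k))" for P :: "nat \<Rightarrow> bool"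
    proof (intro iffI allI impI)
      fix p assume *: "\<forall>i<N. \<forall>k<?n. P (i * ?n + k)" and p: "p < N * ?n"
      have "p div ?n < N" using p by (simp add: less_mult_imp_div_less)
      moreover have "p mod ?n < ?n" by simp
      ultimately have "P (p div ?n * ?n + p mod ?n)" using * by blast
      then show "P p" by (simp only: div_mult_mod_eq)
    next
      fix i k assume "\<forall>p<N * ?n. P p" "i < N" "k < ?n"
      then show "P (i * ?n + k)"
        by (simp only: block_index_less)
    qed
    then show ?thesis unfolding cspectrum_iff[OF closed_loop_mat_carrier[OF \<nu>(1)]] by simp
  qed
  let ?w = "\<lambda>z j. \<Sum>l<?n. of_real (\<nu> $ l) * z (j * ?n + l)"
  note CL = closed_loop_mat_apply[OF \<nu>(1), of _ N _ a b c]
  have idx: "(i * ?n + l) div ?n = i" "(i * ?n + l) mod ?n = l" if "l < ?n" for i l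
    using that by (rule block_index_div, rule block_index_mod)
  have \<kappa>0: "\<kappa> \<noteq> 0" using c by (simp add: \<kappa>_def)
  have Re_\<kappa>: "Re (- \<kappa> * \<epsilon>) = - (c * (B_vec r \<bullet> \<nu>)) * Re \<epsilon>" for \<epsilon> by (simp add: \<kappa>_def)
  show ?thesis
  proof (intro subset_antisym subsetI)
    fix \<epsilon> assume "\<epsilon> \<in> ?C"
    then obtain z p where p: "p < N * ?n" "z p \<noteq> 0" and Re: "Re \<epsilon> \<noteq> 0"
      and zC: "\<forall>i<N. \<forall>k<?n.
      (\<Sum>q<N * ?n. of_real (closed_loop_mat N a r b c \<nu> $$ (i * ?n + k, q)) * z q) = \<epsilon> * z (i * ?n + k)"
      unfolding mem_Collect_eq C by blast
    have z: "(\<Sum>l<?n. of_real (A_mat r b $$ (k, l)) * z (i * ?n + l)) - of_real (c * B_vec r $ k) *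
      (\<Sum>j<N. of_real (laplacian N a $$ (i, j)) * ?w z j) = \<epsilon> * z (i * ?n + k)"
      if "i < N" "k < ?n" for i k
      unfolding CL[OF that, symmetric] using zC that by blast
    show "\<epsilon> \<in> ?L \<union> ?A"
    proof (cases "\<exists>i<N. ?w z i \<noteq> 0")
      case True
      have "(\<Sum>j<N. of_real (laplacian N a $$ (i, j)) * ?w z j) = - \<epsilon> / \<kappa> * ?w z i" if i: "i < N" for i
      proof -
        let ?S = "\<Sum>j<N. of_real (laplacian N a $$ (i, j)) * ?w z j"
        have expand: "of_real x * (s - of_real (c * y) * t) = of_real x * s - of_real (c * (x * y)) * t"
          for x y and s t :: complex
          by (simp add: right_diff_distrib mult_ac)
        have collect: "(\<Sum>k<?n. of_real (c * (\<nu> $ k * B_vec r $ k)) * s) =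
            of_real (c * (\<Sum>k<?n. \<nu> $ k * B_vec r $ k)) * s" for s :: complex
          by (simp only: sum_distrib_left sum_distrib_right of_real_sum)
        have "\<epsilon> * ?w z i = (\<Sum>k<?n. of_real (\<nu> $ k) * (\<epsilon> * z (i * ?n + k)))"
          by (simp only: sum_distrib_left mult.left_commute)
        also have "\<dots> = (\<Sum>k<?n. of_real (\<nu> $ k) * ((\<Sum>l<?n. of_real (A_mat r b $$ (k, l)) * z (i * ?n + l))
            - of_real (c * B_vec r $ k) * ?S))"
          by (rule sum.cong[OF refl]) (simp only: z[OF i] lessThan_iff)
        also have "\<dots> = (\<Sum>k<?n. of_real (\<nu> $ k) * (\<Sum>l<?n. of_real (A_mat r b $$ (k, l)) * z (i * ?n + l)))
            - (\<Sum>k<?n. of_real (c * (\<nu> $ k * B_vec r $ k)) * ?S)"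
          by (simp only: expand sum_subtractf)
        also have "\<dots> = - (of_real (c * (\<Sum>k<?n. \<nu> $ k * B_vec r $ k)) * ?S)"
          unfolding \<nu>A collect by (rule diff_0)
        also have "\<dots> = - \<kappa> * ?S" unfolding \<nu>B \<kappa>_def by (rule mult_minus_left[symmetric])
        finally have "\<epsilon> * ?w z i = - \<kappa> * ?S" .
        moreover have "s = - \<epsilon> / \<kappa> * u" if "\<epsilon> * u = - \<kappa> * s" for u s
        proof -
          have "- \<epsilon> / \<kappa> * u = - (\<epsilon> * u) / \<kappa>" by simp
          also have "\<dots> = s" unfolding that using \<kappa>0 by simp
          finally show ?thesis by (rule sym)
        qed
        ultimately show ?thesis by blast
      qed
      then have "- \<epsilon> / \<kappa> \<in> cspectrum (laplacian N a)"
        unfolding cspectrum_iff[OF laplacian_carrier] by (intro exI[of _ "?w z"] conjI True allI impI)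
      moreover have eq: "\<epsilon> = - \<kappa> * (- \<epsilon> / \<kappa>)" using \<kappa>0 by simp
      moreover have "Re (- \<epsilon> / \<kappa>) \<noteq> 0"
      proof
        assume "Re (- \<epsilon> / \<kappa>) = 0"
        then have "Re \<epsilon> = 0" by (subst eq) (simp only: Re_\<kappa> mult_zero_right)
        with Re show False ..
      qed
      ultimately have "\<epsilon> \<in> ?L" by blast
      then show ?thesis ..
    next
      case False
      define i where "i = p div ?n"
      define k where "k = p mod ?n"
      have ik: "i < N" "k < ?n" "p = i * ?n + k"
        unfolding i_def k_def using p(1) by (rule less_mult_imp_div_less) (simp_all only: mod_less_divisor zero_less_Suc Suc_eq_plus1[symmetric] div_mult_mod_eq)
      have "(\<Sum>l<?n. of_real (A_mat r b $$ (k, l)) * z (i * ?n + l)) = \<epsilon> * z (i * ?n + k)" if "k < ?n" for k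
      proof -
        have "of_real (laplacian N a $$ (i, j)) * ?w z j = 0" if "j \<in> {..<N}" for j
          using False that by (simp only: mult_eq_0_iff lessThan_iff) blast
        then have "(\<Sum>j<N. of_real (laplacian N a $$ (i, j)) * ?w z j) = 0" by (rule sum.neutral[OF ballI])
        then show ?thesis using z[OF ik(1) that] by (simp only: mult_zero_right diff_0_right)
      qed
      moreover have "z (i * ?n + k) \<noteq> 0" unfolding ik(3)[symmetric] by (rule p(2))
      ultimately have "\<epsilon> \<in> cspectrum (A_mat r b)"
        unfolding cspectrum_iff[OF A_mat_carrier] using ik(2)
        by (intro exI[of _ "\<lambda>l. z (i * ?n + l)"] conjI exI[of _ k]) simp_all
      then show ?thesis using Re by blast
    qed
  next
    fix \<epsilon> assume "\<epsilon> \<in> ?L \<union> ?A"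
    then consider (A) "\<epsilon> \<in> cspectrum (A_mat r b)" "Re \<epsilon> \<noteq> 0"
      | (L) l where "l \<in> cspectrum (laplacian N a)" "Re l \<noteq> 0" "\<epsilon> = - \<kappa> * l" by blast
    then show "\<epsilon> \<in> ?C"
    proof cases
      case A
      then obtain v where v: "\<exists>k<?n. v k \<noteq> 0"
        "\<And>k. k < ?n \<Longrightarrow> (\<Sum>l<?n. of_real (A_mat r b $$ (k, l)) * v l) = \<epsilon> * v k"
        unfolding cspectrum_iff[OF A_mat_carrier] by blast
      \<comment> \<open>A left null vector annihilates the right eigenvectors for nonzero
        eigenvalues, so the coupling vanishes on the vector that repeats \<open>v\<close> in every
        block.\<close>
      have "\<epsilon> * (\<Sum>l<?n. of_real (\<nu> $ l) * v l) = (\<Sum>k<?n. of_real (\<nu> $ k) * (\<epsilon> * v k))"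
        by (simp only: sum_distrib_left mult.left_commute)
      also have "\<dots> = (\<Sum>k<?n. of_real (\<nu> $ k) * (\<Sum>l<?n. of_real (A_mat r b $$ (k, l)) * v l))"
        by (rule sum.cong[OF refl]) (simp only: v(2) lessThan_iff)
      also have "\<dots> = 0" by (rule \<nu>A)
      finally have \<nu>v: "(\<Sum>l<?n. of_real (\<nu> $ l) * v l) = 0" using A(2) by auto
      define z where "z = (\<lambda>p. v (p mod ?n))"
      have z: "z (i * ?n + l) = v l" if "l < ?n" for i l using idx(2)[OF that] by (simp only: z_def)
      have zS: "(\<Sum>l<?n. f l * z (i * ?n + l)) = (\<Sum>l<?n. f l * v l)" for f i
        by (rule sum.cong[OF refl]) (simp only: z lessThan_iff)
      then have "(\<Sum>q<N * ?n. of_real (closed_loop_mat N a r b c \<nu> $$ (i * ?n + k, q)) * z q) = \<epsilon> * z (i * ?n + k)"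
        if "i < N" "k < ?n" for i k
        unfolding CL[OF that] zS \<nu>v v(2)[OF that(2)] z[OF that(2)] by simp
      moreover obtain k where "k < ?n" "v k \<noteq> 0" using v(1) by blast
      then have "\<exists>p<N * ?n. z p \<noteq> 0"
        using z[of k 0] block_index_less[OF N, of k ?n] by (intro exI[of _ "0 * ?n + k"]) simp
      ultimately show ?thesis using A(2) unfolding mem_Collect_eq C by blast
    next
      case L
      obtain x where x: "\<exists>i<N. x i \<noteq> 0"
        "\<And>i. i < N \<Longrightarrow> (\<Sum>j<N. of_real (laplacian N a $$ (i, j)) * x j) = l * x i"
        using L(1) unfolding cspectrum_iff[OF laplacian_carrier] by blast
      \<comment> \<open>On the tensor product of the Laplacian eigenvector \<open>x\<close> with a
        vector \<open>p\<close>, the closed loop acts as \<open>K\<close> on the second factor.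
        Since \<nu> is a left null vector of \<open>A_mat\<close>, it is a left eigenvector of
        \<open>K\<close> for \<open>- \<kappa> * l\<close>. A matrix and its transpose have the same
        characteristic polynomial, so a right eigenvector \<open>p\<close> exists and need not be
        computed.\<close>
      define K :: "complex mat" where "K = mat ?n ?n (\<lambda>(k, m). of_real (A_mat r b $$ (k, m)) - of_real (c * B_vec r $ k) * l * of_real (\<nu> $ m))"
      have K: "K \<in> carrier_mat ?n ?n" by (simp add: K_def)
      have Kt: "transpose_mat K \<in> carrier_mat ?n ?n" using K by simp
      have "eigenvalue (transpose_mat K) \<epsilon>"
        unfolding eigenvalue_iff_function[OF Kt]
      proof (intro exI[of _ "\<lambda>k. of_real (\<nu> $ k)"] conjI allI impI)
        have "\<nu> $ r \<noteq> 0" using c B_vec_scalar_prod[OF \<nu>(1)] by simp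
        then show "\<exists>i<?n. complex_of_real (\<nu> $ i) \<noteq> 0" by (intro exI[of _ r]) simp
        fix m assume m: "m < ?n"
        have "(\<Sum>k<?n. K\<^sup>T $$ (m, k) * of_real (\<nu> $ k)) =
            (\<Sum>k<?n. of_real (\<nu> $ k * A_mat r b $$ (k, m)) - of_real (c * (\<nu> $ k * B_vec r $ k)) * (l * of_real (\<nu> $ m)))"
          using m by (intro sum.cong) (auto simp: K_def algebra_simps)
        also have "\<dots> = of_real (\<Sum>k<?n. \<nu> $ k * A_mat r b $$ (k, m))
            - of_real (c * (\<Sum>k<?n. \<nu> $ k * B_vec r $ k)) * (l * of_real (\<nu> $ m))"
          by (simp only: sum_subtractf of_real_sum sum_distrib_left sum_distrib_right)
        also have "\<dots> = - (\<kappa> * (l * of_real (\<nu> $ m)))"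
          unfolding \<nu>B \<nu>(2)[OF m] by (simp add: \<kappa>_def)
        finally show "(\<Sum>k<?n. K\<^sup>T $$ (m, k) * of_real (\<nu> $ k)) = \<epsilon> * of_real (\<nu> $ m)"
          by (simp add: L(3))
      qed
      then have "eigenvalue K \<epsilon>"
        by (simp only: eigenvalue_root_char_poly[OF K] eigenvalue_root_char_poly[OF Kt] char_poly_transpose_mat[OF K])
      then obtain p where p: "\<exists>k<?n. p k \<noteq> 0" "\<And>k. k < ?n \<Longrightarrow> (\<Sum>m<?n. K $$ (k, m) * p m) = \<epsilon> * p k"
        unfolding eigenvalue_iff_function[OF K] by blast
      have Kp: "(\<Sum>m<?n. of_real (A_mat r b $$ (k, m)) * p m) - of_real (c * B_vec r $ k) * l * (\<Sum>m<?n. of_real (\<nu> $ m) * p m) = \<epsilon> * p k"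
        if "k < ?n" for k
        unfolding p(2)[OF that, symmetric] sum_distrib_left sum_subtractf[symmetric]
        using that by (intro sum.cong) (auto simp: K_def left_diff_distrib mult.assoc)
      define z where "z = (\<lambda>q. x (q div ?n) * p (q mod ?n))"
      have z: "z (i * ?n + m) = x i * p m" if "m < ?n" for i m
        using idx[OF that] by (simp only: z_def)
      let ?P = "\<Sum>m<?n. of_real (\<nu> $ m) * p m"
      have "(\<Sum>q<N * ?n. of_real (closed_loop_mat N a r b c \<nu> $$ (i * ?n + k, q)) * z q) = \<epsilon> * z (i * ?n + k)"
        if i: "i < N" and k: "k < ?n" for i k
      proof -
        have zS: "(\<Sum>m<?n. f m * z (j * ?n + m)) = x j * (\<Sum>m<?n. f m * p m)" for f j
          unfolding sum_distrib_left
        proof (rule sum.cong[OF refl])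
          fix m assume "m \<in> {..<?n}"
          then have "z (j * ?n + m) = x j * p m" by (intro z) simp
          then show "f m * z (j * ?n + m) = x j * (f m * p m)" by (simp only: mult.left_commute)
        qed
        have "(\<Sum>j<N. of_real (laplacian N a $$ (i, j)) * ?w z j) = l * x i * ?P"
          unfolding zS mult.assoc[symmetric] sum_distrib_right[symmetric] x(2)[OF i] ..
        moreover have "(\<Sum>m<?n. of_real (A_mat r b $$ (k, m)) * z (i * ?n + m)) =
            x i * (\<Sum>m<?n. of_real (A_mat r b $$ (k, m)) * p m)"
          by (rule zS)
        moreover have "u * s - d * (l * u * t) = u * (s - d * l * t)" for u s d t :: complex
          by (simp add: right_diff_distrib mult_ac)
        ultimately have "(\<Sum>q<N * ?n. of_real (closed_loop_mat N a r b c \<nu> $$ (i * ?n + k, q)) * z q) =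
            x i * ((\<Sum>m<?n. of_real (A_mat r b $$ (k, m)) * p m) - of_real (c * B_vec r $ k) * l * ?P)"
          unfolding CL[OF i k] by (simp only:)
        then show ?thesis unfolding Kp[OF k] z[OF k] by (simp only: mult.left_commute)
      qed
      moreover obtain i k where "i < N" "x i \<noteq> 0" "k < ?n" "p k \<noteq> 0" using x(1) p(1) by blast
      then have "\<exists>p<N * ?n. z p \<noteq> 0"
        using z[of k i] block_index_less[of i N k ?n] by (intro exI[of _ "i * ?n + k"]) (simp del: mult_Suc_right)
      moreover have "Re \<epsilon> \<noteq> 0" unfolding L(3) Re_\<kappa> using c L(2) by simp
      ultimately show ?thesis unfolding mem_Collect_eq C by blast
    qed
  qed
qed

section \<open>Consensus\<close>

lemma cspectrum_uminus:
  assumes M: "M \<in> carrier_mat n n"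
  shows "cspectrum (- M) = uminus ` cspectrum M"
proof -
  have M': "- M \<in> carrier_mat n n" using M by simp
  have "\<epsilon> \<in> cspectrum (- M) \<longleftrightarrow> - \<epsilon> \<in> cspectrum M" for \<epsilon>
  proof -
    have "(\<Sum>j<n. complex_of_real ((- M) $$ (i, j)) * v j) = - (\<Sum>j<n. complex_of_real (M $$ (i, j)) * v j)"
      if "i < n" for i and v :: "nat \<Rightarrow> complex"
      unfolding sum_negf[symmetric] using M that by (intro sum.cong) auto
    moreover have "- s = \<epsilon> * u \<longleftrightarrow> s = - \<epsilon> * u" for s u
      by (metis minus_minus mult_minus_left)
    ultimately show ?thesis
      unfolding cspectrum_iff[OF M] cspectrum_iff[OF M'] by (simp cong: conj_cong)
  qed
  then show ?thesis by (force simp: image_iff)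
qed

text \<open>The feedback is linear and depends on the extended states only through their
  projections. Pairs outside \<open>E\<close> have weight 0, so the sum may run over all
  agents.\<close>

lemma cooperative_input_eq:
  fixes Z :: "nat \<Rightarrow> real vec"
  assumes G: "weighted_digraph N E a" and \<nu>: "\<nu> \<in> carrier_vec (r + 1)" and i: "i < N"
  defines "w \<equiv> \<lambda>j. \<Sum>k<r + 1. \<nu> $ k * Z j $ k"
  shows "cooperative_input E a r c \<nu> Z i = - c * (\<Sum>j<N. a i j * (w i - w j))"
proof -
  have nb: "(\<Sum>j\<in>{j. (i, j) \<in> E}. a i j * f j) = (\<Sum>j<N. a i j * f j)" for f :: "nat \<Rightarrow> real"
  proof (rule sum.mono_neutral_left)
    show "{j. (i, j) \<in> E} \<subseteq> {..<N}"
      using G by (auto simp: weighted_digraph_def)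
    have "a i j = 0" if "j < N" "(i, j) \<notin> E" for j
      using G i that unfolding weighted_digraph_def by metis
    then show "\<forall>j\<in>{..<N} - {j. (i, j) \<in> E}. a i j * f j = 0" by simp
  qed simp
  have "\<nu> \<bullet> vec (r + 1) (\<lambda>k. \<Sum>j\<in>{j. (i, j) \<in> E}. a i j * (Z i $ k - Z j $ k))
      = (\<Sum>k<r + 1. \<nu> $ k * (\<Sum>j<N. a i j * (Z i $ k - Z j $ k)))"
    using \<nu> by (simp add: scalar_prod_def lessThan_atLeast0 nb del: sum.lessThan_Suc sum.atLeast0_lessThan_Suc)
  also have "\<dots> = (\<Sum>j<N. \<Sum>k<r + 1. \<nu> $ k * (a i j * (Z i $ k - Z j $ k)))"
    by (simp only: sum_distrib_left, rule sum.swap)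
  also have "\<dots> = (\<Sum>j<N. a i j * (w i - w j))"
    unfolding w_def sum_subtractf[symmetric] sum_distrib_left
    by (intro sum.cong refl) (simp only: right_diff_distrib mult.left_commute)
  finally show ?thesis by (simp add: cooperative_input_def)
qed

lemma zeta_output:
  assumes "\<phi> \<in> carrier_vec (r - \<rho>)" "\<rho> \<le> r" "x \<in> Rn (sdim S)"
  shows "zeta S \<rho> x u \<phi> $ 0 = out S x"
  using zeta_index[OF assms(1,2), of 0] assms(3) by (simp add: Lf_h_def aug_h_def state_part_aug)

text \<open>With \<open>P = X\<^sup>r + b\<^sub>r\<^sub>+\<^sub>1 X\<^sup>r\<^sup>-\<^sup>1 + \<cdots> + b\<^sub>2\<close>, the functional \<open>\<nu>\<close> maps the extended state of an agent to
  \<open>\<nu>\<^sub>r P(d/dt) y\<close>. These quantities obey the Laplacian flow, and \<open>P\<close> is Hurwitz.\<close>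

lemma output_consensus:
  fixes N :: nat and S :: "nat \<Rightarrow> agent"
  assumes smooth: "\<And>i. i < N \<Longrightarrow> smooth_agent (S i) (\<rho> i)"
    and rd: "\<And>i. i < N \<Longrightarrow> relative_degree (S i) (\<rho> i)"
    and nf: "\<And>i. i < N \<Longrightarrow> normal_form (S i) (\<rho> i) (\<psi> i)"
    and G: "weighted_digraph N E a" and tree: "has_spanning_tree N E"
    and r: "\<And>i. i < N \<Longrightarrow> \<rho> i \<le> r"
    and zs: "length zs = r"
      "\<And>k. k \<le> r \<Longrightarrow> coeff (\<Prod>z\<leftarrow>zs. [:- z, 1:]) k = (if k < r then complex_of_real (b (k + 2)) else 1)"
      "\<And>z. z \<in> set zs \<Longrightarrow> Re z < 0"
    and ev: "eigenvector (transpose_mat (A_mat r b)) \<nu> 0"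
    and pos: "0 < B_vec r \<bullet> \<nu>" and c: "0 < c"
    and loop: "closed_loop N S \<rho> \<psi> r b E a c \<nu> x u \<phi>"
    and ij: "i < N" "j < N"
  shows "((\<lambda>t. \<bar>out (S i) (x i t) - out (S j) (x j t)\<bar>) \<longlongrightarrow> 0) at_top"
proof -
  note \<nu> = A_mat_left_null_vector[OF ev]
  have \<nu>r: "B_vec r \<bullet> \<nu> = \<nu> $ r" by (rule B_vec_scalar_prod[OF \<nu>(1)])
  define Z where "Z = (\<lambda>j t. zeta (S j) (\<rho> j) (x j t) (u j t) (\<phi> j t))"
  define v where "v = (\<lambda>i t. cooperative_input E a r c \<nu> (\<lambda>j. Z j t) i)"
  define w where "w = (\<lambda>j t. \<Sum>k<r + 1. \<nu> $ k * Z j t $ k)"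
  have ctrl: "controlled_agent (S i) (\<rho> i) (\<psi> i) r b (x i) (u i) (\<phi> i) (v i)" if "i < N" for i
    using loop that by (simp add: closed_loop_def v_def Z_def)
  have Z': "((\<lambda>s. Z i s $ k) has_real_derivative
      (if k < r then Z i t $ (k + 1) else (\<Sum>l=1..r. - b (l + 1) * Z i t $ l) + v i t)) (at t within {0..})"
    if "i < N" "t \<ge> 0" "k < r + 1" for i t k
    unfolding Z_def
    by (rule zeta_has_derivative[OF smooth rd nf r ctrl]) (use that in auto)
  \<comment> \<open>The linear part drops out as \<nu> is a left null vector, and the input enters
    the last row only, so what remains is \<open>\<nu> $ r * v i t\<close>.\<close>
  have w': "(w i has_real_derivative - (c * (B_vec r \<bullet> \<nu>)) * (\<Sum>j<N. a i j * (w i t - w j t))) (at t within {0..})"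
    if i: "i < N" and t: "t \<ge> 0" for i t
  proof -
    have "(w i has_real_derivative (\<Sum>k<r + 1. \<nu> $ k *
        (if k < r then Z i t $ (k + 1) else (\<Sum>l=1..r. - b (l + 1) * Z i t $ l) + v i t))) (at t within {0..})"
      unfolding w_def by (intro DERIV_sum DERIV_cmult Z' i t) simp
    also have "(\<Sum>k<r + 1. \<nu> $ k *
        (if k < r then Z i t $ (k + 1) else (\<Sum>l=1..r. - b (l + 1) * Z i t $ l) + v i t))
      = (\<Sum>k<r + 1. \<nu> $ k * (\<Sum>l<r + 1. A_mat r b $$ (k, l) * Z i t $ l) + (if k = r then \<nu> $ r * v i t else 0))"
      using A_mat_apply[where x = "\<lambda>l. Z i t $ l" and r = r and b = b, unfolded of_real_eq_id id_apply]
      by (intro sum.cong refl) (simp add: distrib_left del: sum.lessThan_Suc)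
    also have "\<dots> = (\<Sum>k<r + 1. \<Sum>l<r + 1. \<nu> $ k * (A_mat r b $$ (k, l) * Z i t $ l)) + \<nu> $ r * v i t"
      by (simp add: sum.distrib sum_distrib_left del: sum.lessThan_Suc)
    also have "(\<Sum>k<r + 1. \<Sum>l<r + 1. \<nu> $ k * (A_mat r b $$ (k, l) * Z i t $ l))
        = (\<Sum>l<r + 1. (\<Sum>k<r + 1. \<nu> $ k * A_mat r b $$ (k, l)) * Z i t $ l)"
      by (subst sum.swap) (simp only: sum_distrib_right mult.assoc)
    also have "\<dots> = 0" by (intro sum.neutral ballI) (simp only: \<nu>(2) lessThan_iff mult_zero_left)
    also have "0 + \<nu> $ r * v i t = - (c * (B_vec r \<bullet> \<nu>)) * (\<Sum>j<N. a i j * (w i t - w j t))"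
      unfolding v_def cooperative_input_eq[OF G \<nu>(1) i] \<nu>r w_def by simp
    finally show ?thesis .
  qed
  have w0: "((\<lambda>t. w i t - w j t) \<longlongrightarrow> 0) at_top"
    by (rule laplacian_flow_consensus[OF G tree _ w' ij]) (use pos c in simp)
  \<comment> \<open>The entries of an extended state are successive derivatives of the output up to
    order \<open>r\<close>, also for an agent of smaller relative degree. Hence \<open>d k\<close>
    is the derivative of order \<open>k\<close> of the output difference, whatever the two agents
    are.\<close>
  define d where "d = (\<lambda>k t. complex_of_real (Z i t $ k - Z j t $ k))"
  have "(d 0 \<longlongrightarrow> 0) at_top"
  proof (rule factored_ode_decay[where zs = zs])
    show "(d k has_vector_derivative d (Suc k) t) (at t within {0..})" if "k < length zs" "t \<ge> 0" for k t
      unfolding d_def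
      using DERIV_diff[OF Z'[OF ij(1) that(2), of k] Z'[OF ij(2) that(2), of k]] that(1) zs(1)
      by (intro has_vector_derivative_of_real) (simp add: has_real_derivative_iff_has_vector_derivative)
    have "(\<Sum>k\<le>length zs. coeff (\<Prod>z\<leftarrow>zs. [:- z, 1:]) k * d k t) = of_real ((w i t - w j t) / \<nu> $ r)" for t
    proof -
      have "coeff (\<Prod>z\<leftarrow>zs. [:- z, 1:]) k = of_real (\<nu> $ k / \<nu> $ r)" if "k \<le> r" for k
        using zs(2)[OF that] \<nu>(3)[of k] pos \<nu>r that by (cases "k = r") auto
      then have "(\<Sum>k\<le>r. coeff (\<Prod>z\<leftarrow>zs. [:- z, 1:]) k * d k t)
          = (\<Sum>k<r + 1. of_real (\<nu> $ k / \<nu> $ r) * d k t)"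
        by (intro sum.cong) auto
      also have "\<dots> = of_real (\<Sum>k<r + 1. \<nu> $ k / \<nu> $ r * (Z i t $ k - Z j t $ k))"
        unfolding d_def by (simp only: of_real_sum of_real_mult)
      also have "(\<Sum>k<r + 1. \<nu> $ k / \<nu> $ r * (Z i t $ k - Z j t $ k)) = (w i t - w j t) / \<nu> $ r"
        unfolding w_def sum_subtractf[symmetric] sum_divide_distrib
        by (intro sum.cong refl) (simp add: right_diff_distrib diff_divide_distrib)
      finally show ?thesis using zs(1) by simp
    qed
    moreover have "((\<lambda>t. complex_of_real ((w i t - w j t) / \<nu> $ r)) \<longlongrightarrow> of_real (0 / \<nu> $ r)) at_top"
      using pos \<nu>r by (intro tendsto_of_real tendsto_divide w0 tendsto_const) simp
    ultimately show "((\<lambda>t. \<Sum>k\<le>length zs. coeff (\<Prod>z\<leftarrow>zs. [:- z, 1:]) k * d k t) \<longlongrightarrow> 0) at_top"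
      by simp
  qed (rule zs(3))
  then have "((\<lambda>t. norm (d 0 t)) \<longlongrightarrow> 0) at_top" by (rule tendsto_norm_zero)
  moreover have "eventually (\<lambda>t. norm (d 0 t) = \<bar>out (S i) (x i t) - out (S j) (x j t)\<bar>) at_top"
    using eventually_ge_at_top[of 0]
  proof eventually_elim
    case (elim t)
    have "Z i t $ 0 = out (S i) (x i t)" if "i < N" for i
      using ctrl[OF that] elim unfolding Z_def controlled_agent_def
      by (intro zeta_output[where r = r] r that) auto
    then show ?case using ij by (simp add: d_def del: of_real_diff)
  qed
  ultimately show ?thesis by (rule Lim_transform_eventually)
qed

text \<open>Off the imaginary axis the Laplacian eigenvalues have positive and those of
  \<open>A_mat\<close> negative real parts. All absolute values thus resolve by a change of sign,
  and the minimum splits over the two families. Both are nonempty, by \<open>2 \<le> N\<close> and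
  by \<open>ex\<close>, so each part is a genuine minimum.\<close>

lemma closed_loop_consensus_speed:
  assumes G: "weighted_digraph N E a" and tree: "has_spanning_tree N E" and N: "2 \<le> N"
    and ev: "eigenvector (transpose_mat (A_mat r b)) \<nu> 0"
    and pos: "0 < c * (B_vec r \<bullet> \<nu>)"
    and ex: "\<exists>\<epsilon>\<in>cspectrum (A_mat r b). Re \<epsilon> \<noteq> 0"
    and neg: "\<And>\<epsilon>. \<epsilon> \<in> cspectrum (A_mat r b) \<Longrightarrow> \<epsilon> \<noteq> 0 \<Longrightarrow> Re \<epsilon> < 0"
  shows "consensus_speed (closed_loop_mat N a r b c \<nu>) =
    min (c * (B_vec r \<bullet> \<nu>) * Re (lambda_min (laplacian N a))) (Re (lambda_min (- A_mat r b)))"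
proof -
  define \<kappa> where "\<kappa> = c * (B_vec r \<bullet> \<nu>)"
  have \<kappa>: "\<kappa> > 0" using pos by (simp add: \<kappa>_def)
  define X where "X = {Re \<epsilon> | \<epsilon>. \<epsilon> \<in> cspectrum (laplacian N a) \<and> Re \<epsilon> \<noteq> 0}"
  define Y where "Y = {Re \<epsilon> | \<epsilon>. \<epsilon> \<in> cspectrum (- A_mat r b) \<and> Re \<epsilon> \<noteq> 0}"
  have mA: "- A_mat r b \<in> carrier_mat (r + 1) (r + 1)" using A_mat_carrier by simp
  have exL: "\<exists>\<epsilon>\<in>cspectrum (laplacian N a). Re \<epsilon> \<noteq> 0"
    by (rule spanning_tree_nonzero_eigenvalue[OF G tree N])
  have exA: "\<exists>\<epsilon>\<in>cspectrum (- A_mat r b). Re \<epsilon> \<noteq> 0"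
    using ex unfolding cspectrum_uminus[OF A_mat_carrier] by force
  have X: "finite X" "X \<noteq> {}" and Y: "finite Y" "Y \<noteq> {}"
    using finite_cspectrum[OF laplacian_carrier] finite_cspectrum[OF mA] exL exA by (auto simp: X_def Y_def)
  have L_pos: "0 < Re \<epsilon>" if \<epsilon>: "\<epsilon> \<in> cspectrum (laplacian N a)" "Re \<epsilon> \<noteq> 0" for \<epsilon>
  proof -
    obtain v where "\<exists>i<N. v i \<noteq> 0" "\<forall>i<N. (\<Sum>j<N. of_real (laplacian N a $$ (i, j)) * v j) = \<epsilon> * v i"
      using \<epsilon>(1) unfolding cspectrum_iff[OF laplacian_carrier] by blast
    then show ?thesis
      using laplacian_eigenvalue[of N a v \<epsilon>] weighted_digraph_nonneg[OF G] \<epsilon>(2)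
      by (auto simp: laplacian_apply)
  qed
  have "{\<bar>Re \<epsilon>\<bar> | \<epsilon>. \<epsilon> \<in> cspectrum (closed_loop_mat N a r b c \<nu>) \<and> Re \<epsilon> \<noteq> 0} =
      (\<lambda>\<epsilon>. \<bar>Re \<epsilon>\<bar>) ` {\<epsilon> \<in> cspectrum (closed_loop_mat N a r b c \<nu>). Re \<epsilon> \<noteq> 0}"
    by auto
  also have "\<dots> = (\<lambda>\<epsilon>. \<bar>Re (- complex_of_real \<kappa> * \<epsilon>)\<bar>) ` {\<epsilon> \<in> cspectrum (laplacian N a). Re \<epsilon> \<noteq> 0} \<union>
      (\<lambda>\<epsilon>. \<bar>Re \<epsilon>\<bar>) ` {\<epsilon> \<in> cspectrum (A_mat r b). Re \<epsilon> \<noteq> 0}"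
    using closed_loop_spectrum[OF ev, of c N a] pos N by (simp only: \<kappa>_def image_Un image_image)
  also have "(\<lambda>\<epsilon>. \<bar>Re (- complex_of_real \<kappa> * \<epsilon>)\<bar>) ` {\<epsilon> \<in> cspectrum (laplacian N a). Re \<epsilon> \<noteq> 0} =
      (\<lambda>\<epsilon>. \<kappa> * Re \<epsilon>) ` {\<epsilon> \<in> cspectrum (laplacian N a). Re \<epsilon> \<noteq> 0}"
  proof (rule image_cong[OF refl])
    fix \<epsilon> assume "\<epsilon> \<in> {\<epsilon> \<in> cspectrum (laplacian N a). Re \<epsilon> \<noteq> 0}"
    then have "0 < \<kappa> * Re \<epsilon>" using L_pos \<kappa> by simp
    then show "\<bar>Re (- complex_of_real \<kappa> * \<epsilon>)\<bar> = \<kappa> * Re \<epsilon>" by simp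
  qed
  also have "\<dots> = (\<lambda>s. \<kappa> * s) ` X" by (auto simp: X_def)
  also have "(\<lambda>\<epsilon>. \<bar>Re \<epsilon>\<bar>) ` {\<epsilon> \<in> cspectrum (A_mat r b). Re \<epsilon> \<noteq> 0} = Y"
  proof -
    have "(\<lambda>\<epsilon>. \<bar>Re \<epsilon>\<bar>) ` {\<epsilon> \<in> cspectrum (A_mat r b). Re \<epsilon> \<noteq> 0} =
        (\<lambda>\<epsilon>. Re (- \<epsilon>)) ` {\<epsilon> \<in> cspectrum (A_mat r b). Re \<epsilon> \<noteq> 0}"
    proof (rule image_cong[OF refl])
      fix \<epsilon> assume "\<epsilon> \<in> {\<epsilon> \<in> cspectrum (A_mat r b). Re \<epsilon> \<noteq> 0}"
      then show "\<bar>Re \<epsilon>\<bar> = Re (- \<epsilon>)" using neg[of \<epsilon>] by force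
    qed
    also have "\<dots> = Y" unfolding Y_def cspectrum_uminus[OF A_mat_carrier] by force
    finally show ?thesis .
  qed
  finally have "consensus_speed (closed_loop_mat N a r b c \<nu>) = Min ((\<lambda>s. \<kappa> * s) ` X \<union> Y)"
    unfolding consensus_speed_def by (rule arg_cong)
  also have "\<dots> = min (Min ((\<lambda>s. \<kappa> * s) ` X)) (Min Y)"
    using X Y by (intro Min_Un) simp_all
  also have "Min ((\<lambda>s. \<kappa> * s) ` X) = \<kappa> * Min X"
    using X \<kappa> by (intro mono_Min_commute[symmetric]) (auto intro!: monoI mult_left_mono)
  also have "Min X = Re (lambda_min (laplacian N a))"
    unfolding X_def by (rule Re_lambda_min[OF laplacian_carrier exL, symmetric])
  also have "Min Y = Re (lambda_min (- A_mat r b))"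
    unfolding Y_def by (rule Re_lambda_min[OF mA exA, symmetric])
  finally show ?thesis by (simp only: \<kappa>_def)
qed

text \<open>An eigenvector is determined only up to a nonzero factor. The condition
  \<open>0 < B_vec r \<bullet> \<nu>\<close> selects the sign for which the feedback drives the
  agents together; a positive rescaling of \<nu> rescales the gain in the closed loop and in the
  speed formula alike.\<close>

theorem theorem3:
  fixes N :: nat
    and S :: "nat \<Rightarrow> agent"
    and \<rho> :: "nat \<Rightarrow> nat"
    and \<psi> :: "nat \<Rightarrow> nat \<Rightarrow> (nat \<Rightarrow> real) \<Rightarrow> real"
    and E :: "(nat \<times> nat) set"
    and a :: "nat \<Rightarrow> nat \<Rightarrow> real"
    and r :: nat
    and b :: "nat \<Rightarrow> real"
    and \<nu> :: "real vec"
    and q\<^sub>1 r' \<mu> :: real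
    and Q\<^sub>1_sqrt :: "real mat"
  assumes "2 \<le> N"
    and "\<And>i. i < N \<Longrightarrow> smooth_agent (S i) (\<rho> i)"
    and "\<And>i. i < N \<Longrightarrow> relative_degree (S i) (\<rho> i)"
    and "\<And>i. i < N \<Longrightarrow> normal_form (S i) (\<rho> i) (\<psi> i)"
    and "\<And>i. i < N \<Longrightarrow>
           iss (\<rho> i + 1) (sdim (S i) - \<rho> i) (nf_theta (S i) (\<rho> i) (\<psi> i))"
    and "weighted_digraph N E a"
    and "has_spanning_tree N E"
    and "r = Max (\<rho> ` {..<N})"
    and "\<And>s :: complex.
           s ^ (r + 1) + (\<Sum>k=2..r + 1. complex_of_real (b k) * s ^ (k - 1)) = 0 \<Longrightarrow>
           s \<in> \<real> \<and> Re s \<le> 0"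
    and "Polynomial.order 0 (char_poly (A_mat r b)) = 1"
    and "\<And>\<epsilon>. \<epsilon> \<in> cspectrum (A_mat r b) \<Longrightarrow> \<epsilon> \<noteq> 0 \<Longrightarrow> Re \<epsilon> < 0"
    and "eigenvector (transpose_mat (A_mat r b)) \<nu> 0"
    and "0 < B_vec r \<bullet> \<nu>"
    and "q\<^sub>1 > 0"
    and "r' > 0"
    and "psd_sqrt (q\<^sub>1 \<cdot>\<^sub>m outer \<nu> \<nu>) Q\<^sub>1_sqrt"
    and "observable Q\<^sub>1_sqrt (A_mat r b) \<or> detectable Q\<^sub>1_sqrt (A_mat r b)"
    and "\<mu> > 0"
  shows "(\<forall>x u \<phi>. closed_loop N S \<rho> \<psi> r b E a (\<mu> * sqrt (q\<^sub>1 * r')) \<nu> x u \<phi> \<longrightarrow>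
            (\<forall>i<N. \<forall>j<N.
               ((\<lambda>t. \<bar>out (S i) (x i t) - out (S j) (x j t)\<bar>) \<longlongrightarrow> 0) at_top)) \<and>
         consensus_speed (closed_loop_mat N a r b (\<mu> * sqrt (q\<^sub>1 * r')) \<nu>) =
           min (\<mu> * sqrt (q\<^sub>1 * r') * (B_vec r \<bullet> \<nu>) * Re (lambda_min (laplacian N a)))
               (Re (lambda_min (- A_mat r b)))"
proof -
  let ?c = "\<mu> * sqrt (q\<^sub>1 * r')"
  have c: "0 < ?c" using assms(14,15,18) by simp
  have \<rho>: "\<rho> i \<le> r" if "i < N" for i
    unfolding assms(8) using that by (intro Max_ge) auto
  have "0 < \<rho> 0" using assms(1) by (intro relative_degree_pos[OF assms(3)]) simp
  then have r: "0 < r" using \<rho>[of 0] assms(1) by simp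
  obtain zs where zs: "length zs = r"
    "\<And>k. k \<le> r \<Longrightarrow> coeff (\<Prod>z\<leftarrow>zs. [:- z, 1:]) k = (if k < r then complex_of_real (b (k + 2)) else 1)"
    "\<And>z. z \<in> set zs \<Longrightarrow> Re z < 0"
    "\<And>z. z \<in> set zs \<Longrightarrow> z ^ (r + 1) = (\<Sum>l=1..r. - of_real (b (l + 1)) * z ^ l)"
    using companion_factorization[of r b, OF r A_mat_simple_zero[OF r assms(10)] assms(9)] by blast
  \<comment> \<open>As \<open>0 < r\<close>, the polynomial \<open>P\<close> has a root. It supplies
    an eigenvalue of \<open>A_mat\<close> with nonzero real part, so that
    \<open>lambda_min (- A_mat r b)\<close> is meaningful.\<close>
  have hd: "hd zs \<in> set zs" using r zs(1) by (cases zs) auto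
  have "\<exists>\<epsilon>\<in>cspectrum (A_mat r b). Re \<epsilon> \<noteq> 0"
    using vandermonde_eigenvalue[OF zs(4)[OF hd]] zs(3)[OF hd] by force
  then have "consensus_speed (closed_loop_mat N a r b ?c \<nu>) =
      min (?c * (B_vec r \<bullet> \<nu>) * Re (lambda_min (laplacian N a))) (Re (lambda_min (- A_mat r b)))"
    using c assms(13) by (intro closed_loop_consensus_speed[OF assms(6,7,1,12) _ _ assms(11)]) auto
  moreover have "((\<lambda>t. \<bar>out (S i) (x i t) - out (S j) (x j t)\<bar>) \<longlongrightarrow> 0) at_top"
    if "closed_loop N S \<rho> \<psi> r b E a ?c \<nu> x u \<phi>" "i < N" "j < N" for x u \<phi> i j
    by (rule output_consensus[OF assms(2-4,6,7) \<rho> zs(1-3) assms(12,13) c that])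
  ultimately show ?thesis by (intro conjI allI impI)
qed

end
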